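(* Assume the smoothness assumption, that $R$ is convex, the sparse minimizer assumption and the non-degeneracy assumption (all stated in the context). Let $J_0>J^\star$ and $\kappa_0>0$ be the constants provided by the sharpness inequality recalled in the context. Let $\alpha,\beta>0$ and let $(\nu_t)_{t\ge0}$ be a projected gradient flow of $J$ (with parameters $\alpha,\beta$). If $J(\nu_0)\le J_0$, then for all $t\ge0$ $$J(\nu_t)-J^\star\ \le\ (J(\nu_0)-J^\star)\,\exp\big(-2\kappa_0\min\{\alpha,\beta\}\,t\big).$$
   Context: Smoothness assumption: $\Theta$ is a compact $d$-dimensional Riemannian manifold without boundary, $\mathcal F$ is a Hilbert space, $\lambda>0$; $\phi:\Theta\to\mathcal F$ and $R:\mathcal F\to\mathbb R_+$ are twice Fréchet differentiable with locally Lipschitz second-order derivatives, and $\nabla R$ is bounded on sublevel sets of $R$. $\mathcal M_+(\Theta)$ is the set of finite nonnegative Borel measures on $\Theta$. For $\nu\in\mathcal M_+(\Theta)$, $$J(\nu)=R\Big(\int_\Theta\phi\,d\nu\Big)+\lambda\,\nu(\Theta),\qquad J^\star=\inf_{\mathcal M_+(\Theta)}J,\qquad J'_\nu(\theta)=\Big\langle\phi(\theta),\nabla R\Big(\int_\Theta\phi\,d\nu\Big)\Big\rangle_{\mathcal F}+\lambda .$$ Sparse minimizer assumption: $J$ has a unique minimizer on $\mathcal M_+(\Theta)$, of the form $\nu^\star=\sum_{i=1}^{m^\star}r_i^2\delta_{\theta_i}$ with $\nu^\star(\Theta)>0$, $r_i>0$ and the $\theta_i$ distinct. Write $f^\star=\int\phi\,d\nu^\star$.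 Non-degeneracy assumption: fix normal coordinates around each $\theta_i$. For $\alpha,\beta>0$ put $\bar\nabla\phi=(2\alpha\phi,\beta\nabla\phi)$, with components $\bar\nabla_0\phi=2\alpha\phi$ and $\bar\nabla_j\phi=\beta\,\partial_j\phi$ for $1\le j\le d$. Let $K$ be the matrix indexed by $\{1,\dots,m^\star\}\times\{0,\dots,d\}$, $$K_{(i,j),(i',j')}=\big\langle r_i\bar\nabla_j\phi(\theta_i),\ \nabla^2R(f^\star)\,r_{i'}\bar\nabla_{j'}\phi(\theta_{i'})\big\rangle_{\mathcal F},$$ and $H_i=\beta^2\nabla^2J'_{\nu^\star}(\theta_i)$. Assume: $\nabla^2R(f^\star)$ is positive definite; $\sigma_{\min}(K)>0$; $\min_i\sigma_{\min}(H_i)>0$; and the only points where $J'_{\nu^\star}$ vanishes are $\theta_1,\dots,\theta_{m^\star}$. (The validity of these conditions does not depend on the choice of $\alpha,\beta>0$.) Sharpness inequality: under these assumptions there exist $J_0>J^\star$ and $\kappa_0>0$ such that for all $\nu\in\mathcal M_+(\Theta)$ with $J(\nu)\le J_0$ and all $\alpha,\beta>0$, $$\frac12\int_\Theta\big(4\alpha|J'_\nu|^2+\beta\|\nabla J'_\nu\|_\theta^2\big)\,d\nu\ \ge\ \kappa_0\min\{\alpha,\beta\}(J(\nu)-J^\star).$$ Projected gradient flow with parameters $\alpha,\beta>0$: a curve $(\nu_t)_{t\ge0}$ in $\mathcal M_+(\Theta)$ solving weakly $\partial_t\nu_t=-4\alpha\,\nu_tJ'_{\nu_t}+\beta\,\mathrm{div}(\nu_t\nabla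 J'_{\nu_t})$, i.e. for every differentiable $\varphi:\Theta\to\mathbb R$, $t\mapsto\int\varphi\,d\nu_t$ is locally absolutely continuous and $\frac{d}{dt}\int\varphi\,d\nu_t=-\int\big(4\alpha\varphi J'_{\nu_t}+\beta\langle\nabla\varphi,\nabla J'_{\nu_t}\rangle_\theta\big)d\nu_t$ for a.e. $t\ge0$. *)

theory Defs
  imports "HOL-Analysis.Analysis"
begin

section \<open>Smooth Riemannian manifolds without boundary\<close>

text \<open>
  A chart is an open set together with a coordinate map; only the values of the map on that set
  matter. The manifold is the whole type \<open>'m\<close>, its dimension is \<open>CARD('d)\<close>, and all chart images
  are open in the full Euclidean space, so there is no boundary.
\<close>

type_synonym ('m, 'd) chart = "'m set \<times> ('m \<Rightarrow> real ^ 'd)"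

abbreviation dom_of :: "('m, 'd::finite) chart \<Rightarrow> 'm set" where
  "dom_of \<equiv> fst"

abbreviation crd :: "('m, 'd::finite) chart \<Rightarrow> 'm \<Rightarrow> real ^ 'd" where
  "crd \<equiv> snd"

definition img :: "('m, 'd::finite) chart \<Rightarrow> (real ^ 'd) set" where
  "img c = crd c ` dom_of c"

definition cinv :: "('m, 'd::finite) chart \<Rightarrow> real ^ 'd \<Rightarrow> 'm" where
  "cinv c = the_inv_into (dom_of c) (crd c)"

definition is_chart :: "('m::topological_space, 'd::finite) chart \<Rightarrow> bool" where
  "is_chart c \<longleftrightarrow> open (dom_of c) \<and> inj_on (crd c) (dom_of c) \<and> open (img c)
     \<and> homeomorphism (dom_of c) (img c) (crd c) (cinv c)"

text \<open>\<open>Ck_on k f S\<close>: \<open>f\<close> is \<open>k\<close> times continuously differentiable on the open set \<open>S\<close>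
  (meant for finite-dimensional domains, where directional derivatives suffice).\<close>

primrec Ck_on ::
  "nat \<Rightarrow> ('a::real_normed_vector \<Rightarrow> 'b::real_normed_vector) \<Rightarrow> 'a set \<Rightarrow> bool" where
  "Ck_on 0 f S = continuous_on S f"
| "Ck_on (Suc k) f S =
     ((\<forall>x\<in>S. f differentiable (at x)) \<and> (\<forall>v. Ck_on k (\<lambda>x. frechet_derivative f (at x) v) S))"

definition smooth_on ::
  "('a::real_normed_vector \<Rightarrow> 'b::real_normed_vector) \<Rightarrow> 'a set \<Rightarrow> bool" where
  "smooth_on f S \<longleftrightarrow> (\<forall>k. Ck_on k f S)"

definition compatible ::
  "('m::topological_space, 'd::finite) chart \<Rightarrow> ('m, 'd) chart \<Rightarrow> bool" where
  "compatible c c' \<longleftrightarrow>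
     smooth_on (crd c' \<circ> cinv c) (crd c ` (dom_of c \<inter> dom_of c'))
   \<and> smooth_on (crd c \<circ> cinv c') (crd c' ` (dom_of c \<inter> dom_of c'))"

text \<open>The atlas is maximal, so that it contains all normal coordinate charts.\<close>

definition smooth_structure :: "('m::topological_space, 'd::finite) chart set \<Rightarrow> bool" where
  "smooth_structure A \<longleftrightarrow>
     (\<forall>c\<in>A. is_chart c) \<and> (\<Union>c\<in>A. dom_of c) = UNIV \<and> (\<forall>c\<in>A. \<forall>c'\<in>A. compatible c c')
   \<and> (\<forall>c. is_chart c \<and> (\<forall>c'\<in>A. compatible c c') \<longrightarrow> c \<in> A)"

text \<open>\<open>G c x\<close> is the Gram matrix of the metric at the point with coordinates \<open>x\<close> in the chart \<open>c\<close>.\<close>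

type_synonym ('m, 'd) metric_tensor = "('m, 'd) chart \<Rightarrow> real ^ 'd \<Rightarrow> real ^ 'd ^ 'd"

definition riemannian_manifold ::
  "('m::topological_space, 'd::finite) chart set \<Rightarrow> ('m, 'd) metric_tensor \<Rightarrow> bool" where
  "riemannian_manifold A G \<longleftrightarrow> smooth_structure A
   \<and> (\<forall>c\<in>A. smooth_on (G c) (img c))
   \<and> (\<forall>c\<in>A. \<forall>x\<in>img c. transpose (G c x) = G c x \<and> (\<forall>v. v \<noteq> 0 \<longrightarrow> v \<bullet> (G c x *v v) > 0))
   \<and> (\<forall>c\<in>A. \<forall>c'\<in>A. \<forall>p\<in>dom_of c \<inter> dom_of c'. \<forall>v w.
        let D = frechet_derivative (crd c' \<circ> cinv c) (at (crd c p))
        in v \<bullet> (G c (crd c p) *v w) = D v \<bullet> (G c' (crd c' p) *v D w))"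

definition pd :: "'d::finite \<Rightarrow> (real ^ 'd \<Rightarrow> 'b::real_normed_vector) \<Rightarrow> real ^ 'd \<Rightarrow> 'b" where
  "pd j f x = frechet_derivative f (at x) (axis j 1)"

text \<open>A tangent vector at a point is represented by its components in every chart around the
  point. The inner product evaluates in one such chart; by the transformation law of the metric
  the result does not depend on which one.\<close>

definition grad_vec ::
  "('m, 'd::finite) metric_tensor \<Rightarrow> ('m \<Rightarrow> real) \<Rightarrow> 'm \<Rightarrow> ('m, 'd) chart \<Rightarrow> real ^ 'd" where
  "grad_vec G u p c = matrix_inv (G c (crd c p)) *v (\<chi> j. pd j (u \<circ> cinv c) (crd c p))"

definition riem_inner ::
  "('m, 'd::finite) chart set \<Rightarrow> ('m, 'd) metric_tensor \<Rightarrow> 'm \<Rightarrow>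
   (('m, 'd) chart \<Rightarrow> real ^ 'd) \<Rightarrow> (('m, 'd) chart \<Rightarrow> real ^ 'd) \<Rightarrow> real" where
  "riem_inner A G p X Y =
     (let c = (SOME c. c \<in> A \<and> p \<in> dom_of c) in X c \<bullet> (G c (crd c p) *v Y c))"

definition riem_norm ::
  "('m, 'd::finite) chart set \<Rightarrow> ('m, 'd) metric_tensor \<Rightarrow> 'm \<Rightarrow>
   (('m, 'd) chart \<Rightarrow> real ^ 'd) \<Rightarrow> real" where
  "riem_norm A G p X = sqrt (riem_inner A G p X X)"

text \<open>\<open>christoffel G c x k i j\<close> is the symbol with upper index \<open>k\<close> and lower indices \<open>i\<close>, \<open>j\<close>.\<close>

definition christoffel ::
  "('m, 'd::finite) metric_tensor \<Rightarrow> ('m, 'd) chart \<Rightarrow> real ^ 'd \<Rightarrow> 'd \<Rightarrow> 'd \<Rightarrow> 'd \<Rightarrow> real" where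
  "christoffel G c x k i j =
     (1/2) * (\<Sum>l\<in>UNIV. matrix_inv (G c x) $ k $ l *
       (pd i (\<lambda>y. G c y $ j $ l) x + pd j (\<lambda>y. G c y $ i $ l) x - pd l (\<lambda>y. G c y $ i $ j) x))"

text \<open>Components, in the chart \<open>c\<close>, of the Riemannian (covariant) Hessian.\<close>

definition hessian_mat ::
  "('m, 'd::finite) metric_tensor \<Rightarrow> ('m, 'd) chart \<Rightarrow> ('m \<Rightarrow> real) \<Rightarrow> 'm \<Rightarrow> real ^ 'd ^ 'd" where
  "hessian_mat G c u p =
     (\<chi> j k. pd j (pd k (u \<circ> cinv c)) (crd c p)
        - (\<Sum>l\<in>UNIV. christoffel G c (crd c p) l j k * pd l (u \<circ> cinv c) (crd c p)))"

text \<open>\<open>I\<close> is meant to be open.\<close>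

definition geodesic_on ::
  "('m::topological_space, 'd::finite) chart set \<Rightarrow> ('m, 'd) metric_tensor \<Rightarrow>
   real set \<Rightarrow> (real \<Rightarrow> 'm) \<Rightarrow> bool" where
  "geodesic_on A G I \<gamma> \<longleftrightarrow> continuous_on I \<gamma> \<and>
     (\<forall>c\<in>A. \<exists>y1 y2. \<forall>t\<in>I. \<gamma> t \<in> dom_of c \<longrightarrow>
        ((\<lambda>s. crd c (\<gamma> s)) has_vector_derivative y1 t) (at t)
      \<and> (y1 has_vector_derivative y2 t) (at t)
      \<and> (\<forall>k. y2 t $ k
          + (\<Sum>i\<in>UNIV. \<Sum>j\<in>UNIV. christoffel G c (crd c (\<gamma> t)) k i j * y1 t $ i * y1 t $ j) = 0))"

text \<open>Normal coordinates at \<open>p\<close>: the coordinate basis at \<open>p\<close> is orthonormal, and the point with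
  coordinates \<open>v\<close> is the image under the exponential map at \<open>p\<close> of the tangent vector with
  components \<open>v\<close>, i.e. the rays from the origin are geodesics.\<close>

definition normal_coordinates ::
  "('m::topological_space, 'd::finite) chart set \<Rightarrow> ('m, 'd) metric_tensor \<Rightarrow>
   'm \<Rightarrow> ('m, 'd) chart \<Rightarrow> bool" where
  "normal_coordinates A G p c \<longleftrightarrow> c \<in> A \<and> p \<in> dom_of c \<and> crd c p = 0 \<and> G c 0 = mat 1
   \<and> (\<forall>x\<in>img c. closed_segment 0 x \<subseteq> img c)
   \<and> (\<forall>v. geodesic_on A G {t. t *\<^sub>R v \<in> img c} (\<lambda>t. cinv c (t *\<^sub>R v)))"


section \<open>Differential calculus in Hilbert spaces\<close>

definition twice_frechet_loc_lipschitz ::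
  "('a::real_normed_vector \<Rightarrow> 'b::real_normed_vector) \<Rightarrow> 'a set \<Rightarrow> bool" where
  "twice_frechet_loc_lipschitz f S \<longleftrightarrow>
     (\<exists>(D1 :: 'a \<Rightarrow> 'a \<Rightarrow>\<^sub>L 'b) (D2 :: 'a \<Rightarrow> 'a \<Rightarrow>\<^sub>L ('a \<Rightarrow>\<^sub>L 'b)).
        (\<forall>x\<in>S. (f has_derivative blinfun_apply (D1 x)) (at x)
             \<and> (D1 has_derivative blinfun_apply (D2 x)) (at x))
      \<and> (\<forall>x\<in>S. \<exists>u>0. \<exists>L. L-lipschitz_on (cball x u \<inter> S) D2))"

definition grad :: "('f::{real_inner,complete_space} \<Rightarrow> real) \<Rightarrow> 'f \<Rightarrow> 'f" where
  "grad R f = (THE g. GDERIV R f :> g)"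

definition hess :: "('f::{real_inner,complete_space} \<Rightarrow> real) \<Rightarrow> 'f \<Rightarrow> 'f \<Rightarrow> 'f" where
  "hess R f = frechet_derivative (grad R) (at f)"

text \<open>The Bochner integral of the library requires a second countable target; this is the same
  definition for an arbitrary, possibly non-separable, one.\<close>

definition has_bochner_int ::
  "'a measure \<Rightarrow> ('a \<Rightarrow> 'b::real_normed_vector) \<Rightarrow> 'b \<Rightarrow> bool" where
  "has_bochner_int M f x \<longleftrightarrow> f \<in> borel_measurable M
   \<and> (\<exists>s. (\<forall>i. Bochner_Integration.simple_bochner_integrable M (s i))
        \<and> (\<lambda>i. \<integral>\<^sup>+ y. norm (f y - s i y) \<partial>M) \<longlonglongrightarrow> 0
        \<and> (\<lambda>i. Bochner_Integration.simple_bochner_integral M (s i)) \<longlonglongrightarrow> x)"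

lemma has_bochner_int_iff:
  fixes f :: "'a \<Rightarrow> 'b::{real_normed_vector,second_countable_topology}"
  shows "has_bochner_int M f x \<longleftrightarrow> has_bochner_integral M f x"
  by (auto simp: has_bochner_int_def has_bochner_integral.simps)

definition bochner_int :: "'a measure \<Rightarrow> ('a \<Rightarrow> 'b::real_normed_vector) \<Rightarrow> 'b" where
  "bochner_int M f = (THE x. has_bochner_int M f x)"


section \<open>The objective over nonnegative measures\<close>

definition finite_measures :: "'m::topological_space measure set" where
  "finite_measures = {\<nu>. sets \<nu> = sets borel \<and> finite_measure \<nu>}"

definition J ::
  "('m::topological_space \<Rightarrow> 'f::{real_inner,complete_space}) \<Rightarrow> ('f \<Rightarrow> real) \<Rightarrow> real \<Rightarrow>
   'm measure \<Rightarrow> real" where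
  "J \<phi> R lam \<nu> = R (bochner_int \<nu> \<phi>) + lam * measure \<nu> UNIV"

definition J_star ::
  "('m::topological_space \<Rightarrow> 'f::{real_inner,complete_space}) \<Rightarrow> ('f \<Rightarrow> real) \<Rightarrow> real \<Rightarrow> real" where
  "J_star \<phi> R lam = (INF \<nu>\<in>finite_measures. J \<phi> R lam \<nu>)"

definition J' ::
  "('m::topological_space \<Rightarrow> 'f::{real_inner,complete_space}) \<Rightarrow> ('f \<Rightarrow> real) \<Rightarrow> real \<Rightarrow>
   'm measure \<Rightarrow> 'm \<Rightarrow> real" where
  "J' \<phi> R lam \<nu> \<theta> = \<phi> \<theta> \<bullet> grad R (bochner_int \<nu> \<phi>) + lam"


section \<open>Assumptions\<close>

definition smoothness_assumption ::
  "('m::t2_space, 'd::finite) chart set \<Rightarrow> ('m, 'd) metric_tensor \<Rightarrow>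
   ('m \<Rightarrow> 'f::{real_inner,complete_space}) \<Rightarrow> ('f \<Rightarrow> real) \<Rightarrow> real \<Rightarrow> bool" where
  "smoothness_assumption A G \<phi> R lam \<longleftrightarrow>
     compact (UNIV :: 'm set) \<and> riemannian_manifold A G \<and> lam > 0
   \<and> (\<forall>c\<in>A. twice_frechet_loc_lipschitz (\<phi> \<circ> cinv c) (img c))
   \<and> (\<forall>f. R f \<ge> 0) \<and> twice_frechet_loc_lipschitz R UNIV
   \<and> (\<forall>a. bounded (grad R ` {f. R f \<le> a}))"

definition dirac_sum ::
  "('i::finite \<Rightarrow> real) \<Rightarrow> ('i \<Rightarrow> 'm::topological_space) \<Rightarrow> 'm measure" where
  "dirac_sum w \<theta> = measure_of UNIV (sets borel) (\<lambda>B. \<Sum>i\<in>UNIV. ennreal (w i) * indicator B (\<theta> i))"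

lemma sets_dirac_sum: "sets (dirac_sum w \<theta>) = sets borel"
  using sets.sets_measure_of_eq[of borel] by (simp add: dirac_sum_def)

lemma emeasure_dirac_sum:
  assumes "B \<in> sets borel"
  shows "emeasure (dirac_sum w \<theta>) B = (\<Sum>i\<in>UNIV. ennreal (w i) * indicator B (\<theta> i))"
proof (rule emeasure_measure_of[OF dirac_sum_def])
  show "B \<in> sets (dirac_sum w \<theta>)"
    using assms by (simp add: sets_dirac_sum)
  show "positive (sets (dirac_sum w \<theta>)) (\<lambda>B. \<Sum>i\<in>UNIV. ennreal (w i) * indicator B (\<theta> i))"
    by (simp add: positive_def)
  show "countably_additive (sets (dirac_sum w \<theta>))
          (\<lambda>B. \<Sum>i\<in>UNIV. ennreal (w i) * indicator B (\<theta> i))"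
  proof (rule countably_additiveI)
    fix F :: "nat \<Rightarrow> 'a set"
    assume "disjoint_family F"
    then have "(\<Sum>n. indicator (F n) x) = (indicator (\<Union>n. F n) x :: ennreal)" for x
      by (rule suminf_indicator)
    then show "(\<Sum>n. \<Sum>i\<in>UNIV. ennreal (w i) * indicator (F n) (\<theta> i))
        = (\<Sum>i\<in>UNIV. ennreal (w i) * indicator (\<Union> (range F)) (\<theta> i))"
      by (subst suminf_sum) auto
  qed
qed auto

text \<open>The index type \<open>'i\<close> plays the role of the index set of the atoms, so their number is
  \<open>CARD('i)\<close>.\<close>

definition sparse_minimizer ::
  "('m::topological_space \<Rightarrow> 'f::{real_inner,complete_space}) \<Rightarrow> ('f \<Rightarrow> real) \<Rightarrow> real \<Rightarrow>
   ('i::finite \<Rightarrow> real) \<Rightarrow> ('i \<Rightarrow> 'm) \<Rightarrow> bool" where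
  "sparse_minimizer \<phi> R lam r \<theta> \<longleftrightarrow>
     (let \<nu>star = dirac_sum (\<lambda>i. (r i)\<^sup>2) \<theta> in
       {\<nu>\<in>finite_measures. \<forall>\<mu>\<in>finite_measures. J \<phi> R lam \<nu> \<le> J \<phi> R lam \<mu>} = {\<nu>star}
     \<and> measure \<nu>star UNIV > 0 \<and> (\<forall>i. r i > 0) \<and> inj \<theta>)"

definition sigma_min :: "real ^ 'n ^ 'n \<Rightarrow> real" where
  "sigma_min M = sqrt (Min {e. \<exists>v. v \<noteq> 0 \<and> (transpose M ** M) *v v = e *\<^sub>R v})"

text \<open>The component index \<open>None\<close> stands for \<open>0\<close>, and \<open>Some j\<close> for a coordinate direction \<open>j\<close>.\<close>

definition grad_bar ::
  "real \<Rightarrow> real \<Rightarrow> ('m, 'd::finite) chart \<Rightarrow> ('m \<Rightarrow> 'f::{real_inner,complete_space}) \<Rightarrow>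
   'd option \<Rightarrow> 'm \<Rightarrow> 'f" where
  "grad_bar \<alpha> \<beta> c \<phi> j p =
     (case j of None \<Rightarrow> (2 * \<alpha>) *\<^sub>R \<phi> p | Some k \<Rightarrow> \<beta> *\<^sub>R pd k (\<phi> \<circ> cinv c) (crd c p))"

definition K_mat ::
  "real \<Rightarrow> real \<Rightarrow> ('i::finite \<Rightarrow> ('m::topological_space, 'd::finite) chart) \<Rightarrow>
   ('m \<Rightarrow> 'f::{real_inner,complete_space}) \<Rightarrow> ('f \<Rightarrow> real) \<Rightarrow> ('i \<Rightarrow> real) \<Rightarrow> ('i \<Rightarrow> 'm) \<Rightarrow>
   real ^ ('i \<times> 'd option) ^ ('i \<times> 'd option)" where
  "K_mat \<alpha> \<beta> x \<phi> R r \<theta> =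
     (let fstar = bochner_int (dirac_sum (\<lambda>i. (r i)\<^sup>2) \<theta>) \<phi>;
          g = (\<lambda>(i, j). r i *\<^sub>R grad_bar \<alpha> \<beta> (x i) \<phi> j (\<theta> i))
      in (\<chi> a b. g a \<bullet> hess R fstar (g b)))"

definition H_mat ::
  "real \<Rightarrow> ('i::finite \<Rightarrow> ('m::topological_space, 'd::finite) chart) \<Rightarrow> ('m, 'd) metric_tensor \<Rightarrow>
   ('m \<Rightarrow> 'f::{real_inner,complete_space}) \<Rightarrow> ('f \<Rightarrow> real) \<Rightarrow> real \<Rightarrow> ('i \<Rightarrow> real) \<Rightarrow> ('i \<Rightarrow> 'm) \<Rightarrow>
   'i \<Rightarrow> real ^ 'd ^ 'd" where
  "H_mat \<beta> x G \<phi> R lam r \<theta> i =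
     \<beta>\<^sup>2 *\<^sub>R hessian_mat G (x i) (J' \<phi> R lam (dirac_sum (\<lambda>i. (r i)\<^sup>2) \<theta>)) (\<theta> i)"

definition non_degenerate ::
  "real \<Rightarrow> real \<Rightarrow> ('i::finite \<Rightarrow> ('m::topological_space, 'd::finite) chart) \<Rightarrow>
   ('m, 'd) metric_tensor \<Rightarrow> ('m \<Rightarrow> 'f::{real_inner,complete_space}) \<Rightarrow> ('f \<Rightarrow> real) \<Rightarrow> real \<Rightarrow>
   ('i \<Rightarrow> real) \<Rightarrow> ('i \<Rightarrow> 'm) \<Rightarrow> bool" where
  "non_degenerate \<alpha> \<beta> x G \<phi> R lam r \<theta> \<longleftrightarrow>
     (let \<nu>star = dirac_sum (\<lambda>i. (r i)\<^sup>2) \<theta>; fstar = bochner_int \<nu>star \<phi> in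
       (\<forall>h. h \<noteq> 0 \<longrightarrow> h \<bullet> hess R fstar h > 0)
     \<and> sigma_min (K_mat \<alpha> \<beta> x \<phi> R r \<theta>) > 0
     \<and> (MIN i. sigma_min (H_mat \<beta> x G \<phi> R lam r \<theta> i)) > 0
     \<and> {p. J' \<phi> R lam \<nu>star p = 0} = range \<theta>)"


section \<open>Sharpness and projected gradient flows\<close>

definition sharpness ::
  "('m::topological_space, 'd::finite) chart set \<Rightarrow> ('m, 'd) metric_tensor \<Rightarrow>
   ('m \<Rightarrow> 'f::{real_inner,complete_space}) \<Rightarrow> ('f \<Rightarrow> real) \<Rightarrow> real \<Rightarrow> real \<Rightarrow> real \<Rightarrow> bool" where
  "sharpness A G \<phi> R lam J0 \<kappa>0 \<longleftrightarrow>
     (\<forall>\<nu>\<in>finite_measures. J \<phi> R lam \<nu> \<le> J0 \<longrightarrow> (\<forall>\<alpha>>0. \<forall>\<beta>>0.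
        (1/2) * (\<integral>p. 4 * \<alpha> * \<bar>J' \<phi> R lam \<nu> p\<bar>\<^sup>2
                    + \<beta> * (riem_norm A G p (grad_vec G (J' \<phi> R lam \<nu>) p))\<^sup>2 \<partial>\<nu>)
        \<ge> \<kappa>0 * min \<alpha> \<beta> * (J \<phi> R lam \<nu> - J_star \<phi> R lam)))"

text \<open>Absolute continuity on \<open>{a..b}\<close>, with finite families of non-overlapping subintervals.\<close>

definition abs_cont_on :: "real \<Rightarrow> real \<Rightarrow> (real \<Rightarrow> real) \<Rightarrow> bool" where
  "abs_cont_on a b h \<longleftrightarrow> (\<forall>\<epsilon>>0. \<exists>\<delta>>0. \<forall>(n::nat) u v.
     (\<forall>k<n. a \<le> u k \<and> u k \<le> v k \<and> v k \<le> b)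
   \<and> (\<forall>k<n. \<forall>l<n. k \<noteq> l \<longrightarrow> {u k<..<v k} \<inter> {u l<..<v l} = {})
   \<and> (\<Sum>k<n. v k - u k) < \<delta>
   \<longrightarrow> (\<Sum>k<n. \<bar>h (v k) - h (u k)\<bar>) < \<epsilon>)"

definition C1_function ::
  "('m::topological_space, 'd::finite) chart set \<Rightarrow> ('m \<Rightarrow> real) \<Rightarrow> bool" where
  "C1_function A \<psi> \<longleftrightarrow> (\<forall>c\<in>A. Ck_on 1 (\<psi> \<circ> cinv c) (img c))"

text \<open>Test functions are continuously differentiable: this is what makes the right-hand side a
  well-defined integral for every finite measure, since the gradient of a function that is merely
  differentiable at every point may be unbounded and not integrable.\<close>

definition projected_gradient_flow ::
  "('m::topological_space, 'd::finite) chart set \<Rightarrow> ('m, 'd) metric_tensor \<Rightarrow>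
   ('m \<Rightarrow> 'f::{real_inner,complete_space}) \<Rightarrow> ('f \<Rightarrow> real) \<Rightarrow> real \<Rightarrow> real \<Rightarrow> real \<Rightarrow>
   (real \<Rightarrow> 'm measure) \<Rightarrow> bool" where
  "projected_gradient_flow A G \<phi> R lam \<alpha> \<beta> \<nu> \<longleftrightarrow>
     (\<forall>t\<ge>0. \<nu> t \<in> finite_measures)
   \<and> (\<forall>\<psi>. C1_function A \<psi> \<longrightarrow>
        (\<forall>T\<ge>0. abs_cont_on 0 T (\<lambda>t. \<integral>p. \<psi> p \<partial>\<nu> t))
      \<and> (AE t in lborel. t \<ge> 0 \<longrightarrow>
          ((\<lambda>s. \<integral>p. \<psi> p \<partial>\<nu> s) has_real_derivative
             - (\<integral>p. 4 * \<alpha> * \<psi> p * J' \<phi> R lam (\<nu> t) p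
                   + \<beta> * riem_inner A G p (grad_vec G \<psi> p) (grad_vec G (J' \<phi> R lam (\<nu> t)) p)
                 \<partial>\<nu> t)) (at t within {0..})))"

end

theory Submission
  imports Defs
begin

text \<open>
  By convexity of \<open>R\<close>, the increment of \<open>J\<close> along the flow over \<open>[s, t]\<close> is at most the increment of
  \<open>\<integral> J'\<^sub>t d\<nu>\<close>, where \<open>J'\<^sub>t\<close> is the first variation frozen at time \<open>t\<close>. This is an admissible test
  function, and as \<open>s\<close> tends to \<open>t\<close> the weak formulation bounds the rate of that increment by minus the
  dissipation, hence, by the sharpness inequality, by \<open>-2 \<kappa>\<^sub>0 min {\<alpha>, \<beta>} (J - J\<^sup>*)\<close>. So the left Dini
  derivative of \<open>J\<close> is controlled at every time, and no chain rule along the flow, which would involve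
  uncountably many test functions and their null sets, is needed. The frozen first variation
  converges because \<open>\<integral> \<phi> d\<nu>\<close> is locally Lipschitz in time: the gradient of \<open>R\<close> stays bounded
  along the flow by Jensen's inequality and its boundedness on sublevel sets. The threshold \<open>J\<^sub>0\<close>
  is never crossed because the dissipation is nonnegative.
\<close>

section \<open>Gradients in Hilbert spaces\<close>

text \<open>The representing vector is the minimiser of the quadratic energy
  \<open>E x = |x|^2 / 2 - L x\<close>: a minimising sequence is Cauchy by the parallelogram
  identity, and stationarity at its limit is the asserted identity.\<close>

lemma riesz_representation:
  fixes L :: "'a::{real_inner,complete_space} \<Rightarrow> real"
  assumes "bounded_linear L"
  shows "\<exists>g. \<forall>x. L x = x \<bullet> g"
proof -
  interpret bounded_linear L by fact
  obtain K where K: "K > 0" "\<And>x. norm (L x) \<le> norm x * K"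
    using pos_bounded by blast
  define E where "E x = (norm x)\<^sup>2 / 2 - L x" for x
  define m where "m = Inf (range E)"
  have lower: "- (K\<^sup>2 / 2) \<le> E x" for x
  proof -
    have "L x \<le> norm x * K"
      using K(2)[of x] by (simp add: abs_le_iff)
    moreover have "0 \<le> (norm x - K)\<^sup>2"
      by simp
    ultimately show ?thesis
      by (simp add: E_def power2_eq_square algebra_simps)
  qed
  then have bdd: "bdd_below (range E)"
    by (auto intro!: bdd_belowI)
  have m_le: "m \<le> E x" for x
    unfolding m_def by (rule cInf_lower[OF _ bdd]) simp
  have "\<exists>x. E x < m + 1 / (real n + 1)" for n
    using cInf_lessD[of "range E" "m + 1 / (real n + 1)"] by (auto simp: m_def)
  then obtain X where X: "\<And>n. E (X n) < m + 1 / (real n + 1)"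
    by metis
  \<comment> \<open>Parallelogram identity at the midpoint of \<open>x\<close> and \<open>y\<close>,
    whose energy is at least \<open>m\<close>; it makes near-minimisers close to each other.\<close>
  have par: "(norm (x - y))\<^sup>2 \<le> 4 * (E x - m) + 4 * (E y - m)" for x y
  proof -
    have "E ((1/2) *\<^sub>R (x + y)) = (norm x)\<^sup>2 / 4 + (norm y)\<^sup>2 / 4 - (norm (x - y))\<^sup>2 / 8 - (L x + L y) / 2"
      unfolding E_def power2_norm_eq_inner by (simp add: scaleR add inner_simps inner_commute field_simps)
    then show ?thesis
      using m_le[of "(1/2) *\<^sub>R (x + y)"] unfolding E_def[of x] E_def[of y] by argo
  qed
  have "Cauchy X"
  proof (rule metric_CauchyI)
    fix e :: real assume "e > 0"
    then obtain N where N: "1 / (real N + 1) < e\<^sup>2 / 8"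
      using reals_Archimedean[of "e\<^sup>2 / 8"] by (auto simp: inverse_eq_divide add.commute)
    have "dist (X k) (X l) < e" if "k \<ge> N" "l \<ge> N" for k l
    proof -
      have E_less: "E (X n) < m + e\<^sup>2 / 8" if "n \<ge> N" for n
      proof -
        have "1 / (real n + 1) \<le> 1 / (real N + 1)"
          using that by (simp add: frac_le)
        then have "1 / (real n + 1) < e\<^sup>2 / 8"
          using N by (rule le_less_trans)
        then show ?thesis
          using X[of n] add_less_cancel_left less_trans by blast
      qed
      have "(norm (X k - X l))\<^sup>2 < e\<^sup>2"
        using par[of "X k" "X l"] E_less[OF that(1)] E_less[OF that(2)] by argo
      then show ?thesis
        using \<open>e > 0\<close> by (simp add: dist_norm power2_less_imp_less)
    qed
    then show "\<exists>N. \<forall>k\<ge>N. \<forall>l\<ge>N. dist (X k) (X l) < e"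
      by blast
  qed
  then obtain g where g: "X \<longlonglongrightarrow> g"
    using Cauchy_convergent convergent_def by blast
  have "(\<lambda>n. E (X n)) \<longlonglongrightarrow> E g"
    unfolding E_def by (intro tendsto_intros tendsto g) simp
  moreover have "(\<lambda>n. m + 1 / (real n + 1)) \<longlonglongrightarrow> m"
    using LIMSEQ_inverse_real_of_nat_add[of m] by (simp add: inverse_eq_divide add.commute)
  ultimately have Eg: "E g \<le> m"
    by (rule LIMSEQ_le) (auto intro: less_imp_le[OF X])
  have "L x = x \<bullet> g" for x
  proof -
    have *: "0 \<le> t * (g \<bullet> x - L x) + t\<^sup>2 * (norm x)\<^sup>2 / 2" for t
      using m_le[of "g + t *\<^sub>R x"] Eg unfolding E_def power2_norm_eq_inner
      by (simp add: add scaleR inner_simps inner_commute power2_eq_square field_simps)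
    define d where "d = g \<bullet> x - L x"
    have "d = 0"
    proof (cases "x = 0")
      case False
      define n where "n = (norm x)\<^sup>2"
      have "n > 0"
        using False by (simp add: n_def)
      \<comment> \<open>\<open>- d / n\<close> is the vertex of the parabola in \<open>t\<close>;
        its value there is \<open>- d^2 / (2 n)\<close>, and minimality of \<open>g\<close> keeps it
        nonnegative, so \<open>d = 0\<close>.\<close>
      then have "(- d / n) * d + (- d / n)\<^sup>2 * n / 2 = - (d\<^sup>2 / (2 * n))"
        by (simp add: field_simps power2_eq_square)
      then have "d\<^sup>2 / (2 * n) \<le> 0"
        using *[of "- d / n"] unfolding d_def[symmetric] n_def[symmetric] by linarith
      then show ?thesis
        using \<open>n > 0\<close> by (simp add: divide_le_0_iff)
    qed (simp add: d_def zero)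
    then show ?thesis
      by (simp add: d_def inner_commute)
  qed
  then show ?thesis by blast
qed

text \<open>\<open>grad\<close> is a definite description. Existence comes from the Riesz vector of
  the derivative, uniqueness from uniqueness of the Frechet derivative.\<close>

lemma GDERIV_grad:
  fixes R :: "'f::{real_inner,complete_space} \<Rightarrow> real"
  assumes "(R has_derivative L) (at x)"
  shows "GDERIV R x :> grad R x"
proof -
  obtain g where "\<And>h. L h = h \<bullet> g"
    using riesz_representation[OF has_derivative_bounded_linear[OF assms]] by blast
  then have "GDERIV R x :> g"
    using assms unfolding gderiv_def by (metis ext)
  moreover have "g' = g" if "GDERIV R x :> g'" for g'
  proof -
    have "(\<lambda>h. h \<bullet> g') = (\<lambda>h. h \<bullet> g)"
      using that \<open>GDERIV R x :> g\<close> unfolding gderiv_def by (rule has_derivative_unique)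
    then show ?thesis
      by (metis vector_eq_ldot)
  qed
  ultimately show ?thesis
    unfolding grad_def by (metis theI)
qed

text \<open>Evaluating the difference of the derivatives in the direction of the difference of the
  gradients shows that \<open>grad R\<close> varies no faster than \<open>D\<close> does in operator
  norm.\<close>

lemma continuous_on_grad:
  fixes R :: "'f::{real_inner,complete_space} \<Rightarrow> real"
  assumes "\<And>x. (R has_derivative blinfun_apply (D x)) (at x)" and "continuous_on UNIV D"
  shows "continuous_on UNIV (grad R)"
proof -
  have dist_le: "dist (grad R y) (grad R x) \<le> dist (D y) (D x)" for x y
  proof -
    have D: "blinfun_apply (D z) h = h \<bullet> grad R z" for z h
      using has_derivative_unique[OF assms(1) GDERIV_grad[OF assms(1), unfolded gderiv_def]] by metis
    define g where "g = grad R y - grad R x"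
    have "(norm g)\<^sup>2 = (D y - D x) g"
      by (simp add: D g_def blinfun.diff_left power2_norm_eq_inner inner_simps)
    also have "\<dots> \<le> norm (D y - D x) * norm g"
      using norm_blinfun[of "D y - D x" g] by simp
    finally have "norm g \<le> norm (D y - D x)"
      by (cases "norm g = 0") (auto simp: power2_eq_square)
    then show ?thesis
      by (simp add: g_def dist_norm)
  qed
  show ?thesis
    using assms(2) unfolding continuous_on_iff by (meson dist_le le_less_trans)
qed

text \<open>Restricting \<open>R\<close> to the line through \<open>x\<close> and \<open>y\<close>
  reduces this to the tangent inequality for a convex function of one real variable.\<close>

lemma convex_grad_ineq:
  fixes R :: "'f::{real_inner,complete_space} \<Rightarrow> real"
  assumes "convex_on UNIV R" and "GDERIV R x :> g"
  shows "R y \<ge> R x + (y - x) \<bullet> g"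
proof -
  define u where "u t = R (x + t *\<^sub>R (y - x))" for t
  have "convex_on UNIV u"
  proof (rule convex_onI)
    fix t p q :: real assume "0 < t" "t < 1"
    have "x + ((1 - t) * p + t * q) *\<^sub>R (y - x)
        = (1 - t) *\<^sub>R (x + p *\<^sub>R (y - x)) + t *\<^sub>R (x + q *\<^sub>R (y - x))"
      by (simp add: algebra_simps)
    then show "u ((1 - t) *\<^sub>R p + t *\<^sub>R q) \<le> (1 - t) * u p + t * u q"
      using convex_onD[OF assms(1), of t "x + p *\<^sub>R (y - x)" "x + q *\<^sub>R (y - x)"] \<open>0 < t\<close> \<open>t < 1\<close>
      by (simp add: u_def)
  qed simp
  moreover have "(u has_real_derivative (y - x) \<bullet> g) (at 0)"
  proof -
    have "((\<lambda>t. x + t *\<^sub>R (y - x)) has_derivative (\<lambda>t. t *\<^sub>R (y - x))) (at 0)"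
      by (auto intro!: derivative_eq_intros)
    from has_derivative_compose[OF this, of R "\<lambda>h. h \<bullet> g"] assms(2) show ?thesis
      by (simp add: u_def[abs_def] gderiv_def has_field_derivative_def mult.commute[of _ "(y - x) \<bullet> g"])
  qed
  ultimately have "u 1 - u 0 \<ge> ((y - x) \<bullet> g) * (1 - 0)"
    by (intro convex_on_imp_above_tangent[where A = UNIV]) auto
  then show ?thesis
    by (simp add: u_def)
qed

section \<open>Bochner integrals with values in a non-separable space\<close>

text \<open>Pairing with a fixed vector carries the approximating simple functions to real ones, so
  that all later computations with vector-valued integrals take place in the scalar theory.\<close>

lemma has_bochner_int_inner:
  assumes "has_bochner_int M f x"
  shows "has_bochner_integral M (\<lambda>y. f y \<bullet> v) (x \<bullet> v)"
proof -
  obtain s where f: "f \<in> borel_measurable M"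
    and s: "\<And>i. Bochner_Integration.simple_bochner_integrable M (s i)"
    and f_s: "(\<lambda>i. \<integral>\<^sup>+ y. norm (f y - s i y) \<partial>M) \<longlonglongrightarrow> 0"
    and lim: "(\<lambda>i. Bochner_Integration.simple_bochner_integral M (s i)) \<longlonglongrightarrow> x"
    using assms unfolding has_bochner_int_def by blast
  have inner_measurable: "(\<lambda>w. w \<bullet> v) \<in> borel_measurable borel"
    by (intro borel_measurable_continuous_onI continuous_intros)
  show ?thesis
  proof (rule has_bochner_integral.intros[where s = "\<lambda>i y. s i y \<bullet> v"])
    show "(\<lambda>y. f y \<bullet> v) \<in> borel_measurable M"
      using measurable_compose[OF f inner_measurable] .
    show "Bochner_Integration.simple_bochner_integrable M (\<lambda>y. s i y \<bullet> v)" for i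
      using Bochner_Integration.simple_bochner_integrable_compose2[OF _ s[of i] s[of i], of "\<lambda>a b. a \<bullet> v"]
      by simp
    show "(\<lambda>i. \<integral>\<^sup>+ y. ennreal (norm (f y \<bullet> v - s i y \<bullet> v)) \<partial>M) \<longlonglongrightarrow> 0"
    proof (rule tendsto_sandwich[OF _ _ tendsto_const])
      show "(\<lambda>i. ennreal (norm v) * (\<integral>\<^sup>+ y. norm (f y - s i y) \<partial>M)) \<longlonglongrightarrow> 0"
        using ennreal_tendsto_cmult[OF _ f_s, of "ennreal (norm v)"] by simp
      have "(\<integral>\<^sup>+ y. ennreal (norm (f y \<bullet> v - s i y \<bullet> v)) \<partial>M)
          \<le> ennreal (norm v) * (\<integral>\<^sup>+ y. norm (f y - s i y) \<partial>M)" for i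
      proof -
        \<comment> \<open>In a non-separable space a difference of measurable functions need not be
          measurable. Here \<open>s i\<close> takes finitely many values, and for each fixed value
          the map is a continuous function of \<open>f\<close>.\<close>
        have "(\<lambda>y. norm (f y - s i y)) \<in> borel_measurable M"
        proof (rule measurable_compose_countable'[where I = "s i ` space M" and g = "s i"])
          show "(\<lambda>y. norm (f y - z)) \<in> borel_measurable M" for z
            by (rule measurable_compose[OF f, of "\<lambda>w. norm (w - z)"])
              (intro borel_measurable_continuous_onI continuous_intros)
          have "simple_function M (s i)"
            using s[of i] by (rule Bochner_Integration.simple_bochner_integrable.cases)
          then show "s i \<in> measurable M (count_space (s i ` space M))" "countable (s i ` space M)"
            by (auto simp: measurable_count_space_eq2 simple_function_def intro: countable_finite)
        qed
        then have "(\<integral>\<^sup>+ y. ennreal (norm v) * ennreal (norm (f y - s i y)) \<partial>M) = ennreal (norm v) * (\<integral>\<^sup>+ y. norm (f y - s i y) \<partial>M)"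
          by (intro nn_integral_cmult) simp
        moreover have "norm (f y \<bullet> v - s i y \<bullet> v) \<le> norm v * norm (f y - s i y)" for y
          using Cauchy_Schwarz_ineq2[of "f y - s i y" v] by (simp add: inner_diff_left mult.commute)
        ultimately show ?thesis
          by (metis (no_types, lifting) ennreal_leI ennreal_mult' norm_ge_zero nn_integral_mono)
      qed
      then show "\<forall>\<^sub>F i in sequentially. (\<integral>\<^sup>+ y. ennreal (norm (f y \<bullet> v - s i y \<bullet> v)) \<partial>M)
          \<le> ennreal (norm v) * (\<integral>\<^sup>+ y. norm (f y - s i y) \<partial>M)"
        by simp
    qed simp
    show "(\<lambda>i. Bochner_Integration.simple_bochner_integral M (\<lambda>y. s i y \<bullet> v)) \<longlonglongrightarrow> x \<bullet> v"
      using tendsto_inner[OF lim tendsto_const, of v]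
      by (subst Bochner_Integration.simple_bochner_integral_linear[where f = "\<lambda>a. a \<bullet> v"])
        (auto intro: s bounded_linear.linear[OF bounded_linear_inner_left])
  qed
qed

text \<open>Total boundedness of the range takes the place of separability: rounding to a finite net
  approximates \<open>f\<close> uniformly by simple functions, and finite mass turns uniform into L1
  closeness.\<close>

lemma has_bochner_int_compact_range:
  fixes f :: "'a \<Rightarrow> 'b::{real_normed_vector,complete_space}"
  assumes "finite_measure M" and f: "f \<in> borel_measurable M" and K: "compact K" "f ` space M \<subseteq> K"
  shows "\<exists>x. has_bochner_int M f x"
proof -
  interpret finite_measure M by fact
  have "\<exists>s. Bochner_Integration.simple_bochner_integrable M s
      \<and> (\<forall>p\<in>space M. norm (f p - s p) < 1 / (real n + 1))" for n
  proof -
    have "\<exists>k. finite k \<and> K \<subseteq> (\<Union>z\<in>k. ball z (1 / (real n + 1)))"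
      using K(1) unfolding compact_eq_totally_bounded by (simp add: add_pos_nonneg)
    then obtain k where k: "finite k" "K \<subseteq> (\<Union>z\<in>k. ball z (1 / (real n + 1)))"
      by blast
    then obtain zs where zs: "set zs = k"
      using finite_list by blast
    \<comment> \<open>Taking the first ball of the net that contains \<open>f p\<close> makes the
      rounding measurable.\<close>
    define i where "i p = (LEAST j. j < length zs \<and> f p \<in> ball (zs ! j) (1 / (real n + 1)))" for p
    have i: "i p < length zs \<and> f p \<in> ball (zs ! i p) (1 / (real n + 1))" if p: "p \<in> space M" for p
    proof -
      obtain z where "z \<in> set zs" "f p \<in> ball z (1 / (real n + 1))"
        using p k K(2) zs by blast
      then have "\<exists>j. j < length zs \<and> f p \<in> ball (zs ! j) (1 / (real n + 1))"
        unfolding in_set_conv_nth by blast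
      then show ?thesis
        unfolding i_def by (rule LeastI_ex)
    qed
    have "i \<in> measurable M (count_space UNIV)"
      unfolding i_def
    proof (intro measurable_Least)
      fix j
      have "f -` ball (zs ! j) (1 / (real n + 1)) \<inter> space M \<in> sets M"
        by (rule measurable_sets[OF f]) simp
      then show "Measurable.pred M (\<lambda>p. j < length zs \<and> f p \<in> ball (zs ! j) (1 / (real n + 1)))"
        by (cases "j < length zs") (auto simp: pred_def vimage_def Int_def conj_commute cong: conj_cong)
    qed
    moreover have fin: "finite (i ` space M)"
      by (rule finite_subset[of _ "{..<length zs}"]) (use i in auto)
    ultimately have "simple_function M i"
      by (auto simp: simple_function_def intro!: measurable_sets[where A = "count_space UNIV"])
    then have "simple_function M (\<lambda>p. zs ! i p)"
      by (rule simple_function_compose1)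
    then have "Bochner_Integration.simple_bochner_integrable M (\<lambda>p. zs ! i p)"
      by (rule Bochner_Integration.simple_bochner_integrable.intros) (simp add: emeasure_eq_measure)
    moreover have "norm (f p - zs ! i p) < 1 / (real n + 1)" if "p \<in> space M" for p
      using i[OF that] by (simp add: dist_norm norm_minus_commute)
    ultimately show ?thesis
      by blast
  qed
  then obtain s where s: "\<And>n. Bochner_Integration.simple_bochner_integrable M (s n)"
    and f_s: "\<And>n p. p \<in> space M \<Longrightarrow> norm (f p - s n p) < 1 / (real n + 1)"
    by metis
  define m where "m = measure M (space M)"
  define I where "I n = Bochner_Integration.simple_bochner_integral M (s n)" for n
  have nn_le: "(\<integral>\<^sup>+ p. ennreal (norm (u p)) \<partial>M) \<le> ennreal (e * m)"
    if "\<And>p. p \<in> space M \<Longrightarrow> norm (u p) \<le> e" "0 \<le> e" for u :: "'a \<Rightarrow> 'b" and e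
  proof -
    have "(\<integral>\<^sup>+ p. ennreal (norm (u p)) \<partial>M) \<le> (\<integral>\<^sup>+ p. ennreal e \<partial>M)"
      using that by (intro nn_integral_mono ennreal_leI)
    then show ?thesis
      using that by (simp add: m_def emeasure_eq_measure ennreal_mult)
  qed
  have I_diff: "norm (I k - I l) \<le> (1 / (real k + 1) + 1 / (real l + 1)) * m" for k l
  proof -
    have d: "Bochner_Integration.simple_bochner_integrable M (\<lambda>p. s k p - s l p)"
      by (rule Bochner_Integration.simple_bochner_integrable_compose2[OF _ s s]) simp
    have nd: "Bochner_Integration.simple_bochner_integrable M (\<lambda>p. norm (s k p - s l p))"
      by (rule Bochner_Integration.simple_bochner_integrable_compose2[OF _ d d, of "\<lambda>a b. norm a"]) simp
    have "norm (s k p - s l p) \<le> 1 / (real k + 1) + 1 / (real l + 1)" if "p \<in> space M" for p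
      using norm_triangle_ineq4[of "f p - s l p" "f p - s k p"] f_s[OF that, of k] f_s[OF that, of l]
      by simp
    then have "(\<integral>\<^sup>+ p. ennreal (norm (s k p - s l p)) \<partial>M) \<le> ennreal ((1 / (real k + 1) + 1 / (real l + 1)) * m)"
      by (rule nn_le) auto
    then have "Bochner_Integration.simple_bochner_integral M (\<lambda>p. norm (s k p - s l p))
        \<le> (1 / (real k + 1) + 1 / (real l + 1)) * m"
      using Bochner_Integration.simple_bochner_integral_eq_nn_integral[OF nd]
      by (subst ennreal_le_iff[symmetric]) (auto simp: m_def)
    then show ?thesis
      using Bochner_Integration.simple_bochner_integral_norm_bound[OF d]
      by (simp add: I_def Bochner_Integration.simple_bochner_integral_diff[OF s s])
  qed
  have m_lim: "(\<lambda>n. 1 / (real n + 1) * m) \<longlonglongrightarrow> 0"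
    using tendsto_mult_left_zero[OF LIMSEQ_inverse_real_of_nat, of m]
    by (simp add: inverse_eq_divide add.commute)
  have "Cauchy I"
  proof (rule metric_CauchyI)
    fix e :: real assume "e > 0"
    then obtain N where N: "\<And>n. n \<ge> N \<Longrightarrow> norm (1 / (real n + 1) * m) < e / 2"
      using LIMSEQ_D[OF m_lim, of "e / 2"] by auto
    have "dist (I k) (I l) < e" if "k \<ge> N" "l \<ge> N" for k l
    proof -
      have "1 / (real k + 1) * m < e / 2" "1 / (real l + 1) * m < e / 2"
        using N[OF that(1)] N[OF that(2)] unfolding real_norm_def by (meson abs_ge_self le_less_trans)+
      then show ?thesis
        using I_diff[of k l] unfolding dist_norm distrib_right by linarith
    qed
    then show "\<exists>N. \<forall>k\<ge>N. \<forall>l\<ge>N. dist (I k) (I l) < e"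
      by blast
  qed
  then obtain x where "I \<longlonglongrightarrow> x"
    using Cauchy_convergent convergent_def by blast
  moreover have "(\<lambda>n. \<integral>\<^sup>+ p. norm (f p - s n p) \<partial>M) \<longlonglongrightarrow> 0"
  proof (rule tendsto_sandwich[OF _ _ tendsto_const])
    show "(\<lambda>n. ennreal (1 / (real n + 1) * m)) \<longlonglongrightarrow> 0"
      using tendsto_ennrealI[OF m_lim] by simp
    show "\<forall>\<^sub>F n in sequentially. (\<integral>\<^sup>+ p. norm (f p - s n p) \<partial>M) \<le> ennreal (1 / (real n + 1) * m)"
      by (intro always_eventually allI nn_le) (auto simp: less_imp_le f_s)
  qed simp
  ultimately show ?thesis
    using f s unfolding has_bochner_int_def I_def by blast
qed

text \<open>The definite description is justified by the scalar case: two values of the integral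
  have the same inner product with every vector.\<close>

lemma has_bochner_int_bochner_int:
  fixes f :: "'a \<Rightarrow> 'b::{real_inner,complete_space}"
  assumes "has_bochner_int M f x"
  shows "has_bochner_int M f (bochner_int M f)"
  unfolding bochner_int_def
proof (rule theI[of _ x])
  fix y assume "has_bochner_int M f y"
  then have "y \<bullet> v = x \<bullet> v" for v
    using has_bochner_int_inner[of M f] assms has_bochner_integral_eq by blast
  then show "y = x"
    by (metis vector_eq_rdot)
qed (fact assms)

section \<open>Absolutely continuous functions and Dini derivatives\<close>

lemma abs_cont_on_subset:
  assumes "abs_cont_on a b h" "a \<le> c" "d \<le> b"
  shows "abs_cont_on c d h"
  unfolding abs_cont_on_def
proof (intro allI impI)
  fix e :: real assume "e > 0"
  then obtain \<delta> where "\<delta> > 0" and \<delta>: "\<And>(n::nat) u v. (\<forall>k<n. a \<le> u k \<and> u k \<le> v k \<and> v k \<le> b)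
      \<and> (\<forall>k<n. \<forall>l<n. k \<noteq> l \<longrightarrow> {u k<..<v k} \<inter> {u l<..<v l} = {})
      \<and> (\<Sum>k<n. v k - u k) < \<delta> \<Longrightarrow> (\<Sum>k<n. \<bar>h (v k) - h (u k)\<bar>) < e"
    using assms(1) unfolding abs_cont_on_def by blast
  moreover have "\<forall>k<n. a \<le> u k \<and> u k \<le> v k \<and> v k \<le> b"
    if "\<forall>k<n. c \<le> u k \<and> u k \<le> v k \<and> v k \<le> d" for n :: nat and u v
    using that assms(2,3) by (meson order_trans)
  ultimately show "\<exists>\<delta>>0. \<forall>(n::nat) u v. (\<forall>k<n. c \<le> u k \<and> u k \<le> v k \<and> v k \<le> d)
      \<and> (\<forall>k<n. \<forall>l<n. k \<noteq> l \<longrightarrow> {u k<..<v k} \<inter> {u l<..<v l} = {})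
      \<and> (\<Sum>k<n. v k - u k) < \<delta> \<longrightarrow> (\<Sum>k<n. \<bar>h (v k) - h (u k)\<bar>) < e"
    by blast
qed

lemma abs_cont_on_imp_continuous_on:
  assumes "abs_cont_on a b h"
  shows "continuous_on {a..b} h"
  unfolding continuous_on_iff
proof (intro ballI allI impI)
  fix x e :: real assume x: "x \<in> {a..b}" and "e > 0"
  obtain \<delta> where "\<delta> > 0" and \<delta>: "\<And>(n::nat) u v. (\<forall>k<n. a \<le> u k \<and> u k \<le> v k \<and> v k \<le> b)
      \<and> (\<forall>k<n. \<forall>l<n. k \<noteq> l \<longrightarrow> {u k<..<v k} \<inter> {u l<..<v l} = {})
      \<and> (\<Sum>k<n. v k - u k) < \<delta> \<Longrightarrow> (\<Sum>k<n. \<bar>h (v k) - h (u k)\<bar>) < e"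
    using assms \<open>e > 0\<close> unfolding abs_cont_on_def by blast
  have "dist (h y) (h x) < e" if "y \<in> {a..b}" "dist y x < \<delta>" for y
    using \<delta>[of 1 "\<lambda>_. min x y" "\<lambda>_. max x y"] x that
    by (cases "x \<le> y") (auto simp: dist_real_def)
  then show "\<exists>d>0. \<forall>y\<in>{a..b}. dist y x < d \<longrightarrow> dist (h y) (h x) < e"
    using \<open>\<delta> > 0\<close> by blast
qed

text \<open>The straddle lemma: splitting at \<open>t\<close>, the errors at the two end points add
  up to at most \<open>e * (v - u)\<close>. This is the form suited to intervals that contain their
  tag.\<close>

lemma has_real_derivative_straddle:
  assumes "(h has_real_derivative D) (at t within S)" "D \<le> C" "e > 0"
  shows "\<exists>d>0. \<forall>u\<in>S. \<forall>v\<in>S. u \<le> t \<and> t \<le> v \<and> \<bar>u - t\<bar> < d \<and> \<bar>v - t\<bar> < d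
    \<longrightarrow> h v - h u \<le> (C + e) * (v - u)"
proof -
  obtain d where "d > 0" and d: "\<And>y. y \<in> S \<Longrightarrow> \<bar>y - t\<bar> < d \<Longrightarrow> \<bar>h y - h t - D * (y - t)\<bar> \<le> e * \<bar>y - t\<bar>"
    using assms(1,3) unfolding has_field_derivative_def has_derivative_within_alt
    by (metis real_norm_def)
  have "h v - h u \<le> (C + e) * (v - u)"
    if "u \<in> S" "v \<in> S" "u \<le> t" "t \<le> v" "\<bar>u - t\<bar> < d" "\<bar>v - t\<bar> < d" for u v
  proof -
    have "\<bar>h v - h t - D * (v - t)\<bar> \<le> e * (v - t)" "\<bar>h u - h t - D * (u - t)\<bar> \<le> e * (t - u)"
      using d[of u] d[of v] that by auto
    then have "h v - h u \<le> (D + e) * (v - u)"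
      by (simp add: algebra_simps abs_le_iff)
    also have "\<dots> \<le> (C + e) * (v - u)"
      using assms(2) that by (intro mult_right_mono) auto
    finally show ?thesis .
  qed
  then show ?thesis
    using \<open>d > 0\<close> by blast
qed

text \<open>Outer regularity. The open set will serve as the gauge at the exceptional tags, which
  bounds the total length of their intervals.\<close>

lemma null_set_open_cover:
  fixes N :: "real set"
  assumes "N \<in> null_sets lborel" "e > 0"
  shows "\<exists>U. open U \<and> N \<subseteq> U \<and> U \<in> lmeasurable \<and> measure lebesgue U < e"
proof -
  have N: "N \<in> sets borel" "emeasure lborel N = 0"
    using assms(1) by auto
  then obtain U where U: "open U" "N \<subseteq> U" "emeasure lborel (U - N) < ennreal e"
    using outer_regular_lborel[of N e] \<open>e > 0\<close> by (metis sets_lborel)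
  have "emeasure lborel U \<le> emeasure lborel (N \<union> (U - N))"
    using N U by (intro emeasure_mono) auto
  also have "\<dots> \<le> emeasure lborel N + emeasure lborel (U - N)"
    using N U by (intro emeasure_subadditive) auto
  finally have *: "emeasure lebesgue U < ennreal e"
    using N U by simp
  then have "U \<in> lmeasurable"
    using U(1) by (auto simp: fmeasurable_def top.not_eq_extremum intro: less_trans)
  then show ?thesis
    using U * \<open>e > 0\<close> by (auto simp: emeasure_eq_measure2 ennreal_less_iff)
qed

text \<open>A fine tagged division splits into intervals tagged outside the exceptional null set, where the
  derivative controls the increment, and the others, whose total length is small, so that absolute
  continuity applies.\<close>

lemma abs_cont_on_increment_le:
  assumes ac: "abs_cont_on a b h" and "a \<le> b"
    and ae: "AE t in lborel. t \<in> {a..b} \<longrightarrow> (\<exists>D\<le>C. (h has_real_derivative D) (at t within {a..b}))"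
  shows "h b - h a \<le> C * (b - a)"
proof -
  have main: "h b - h a \<le> C * (b - a) + e * (b - a + 2)" if "e > 0" for e
  proof -
    obtain \<delta> where "\<delta> > 0" and \<delta>: "\<And>(n::nat) u v. (\<forall>k<n. a \<le> u k \<and> u k \<le> v k \<and> v k \<le> b)
        \<and> (\<forall>k<n. \<forall>l<n. k \<noteq> l \<longrightarrow> {u k<..<v k} \<inter> {u l<..<v l} = {})
        \<and> (\<Sum>k<n. v k - u k) < \<delta> \<Longrightarrow> (\<Sum>k<n. \<bar>h (v k) - h (u k)\<bar>) < e"
      using ac \<open>e > 0\<close> unfolding abs_cont_on_def by blast
    obtain N where N: "N \<in> null_sets lborel"
      "{t \<in> space lborel. \<not> (t \<in> {a..b} \<longrightarrow> (\<exists>D\<le>C. (h has_real_derivative D) (at t within {a..b})))} \<subseteq> N"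
      using ae unfolding eventually_ae_filter by blast
    \<comment> \<open>The bound \<open>\<delta>\<close> feeds absolute continuity; the other one
      pays for leaving the exceptional intervals out of the sum of lengths multiplied by
      \<open>C + e\<close>.\<close>
    obtain U where U: "open U" "N \<subseteq> U" "U \<in> lmeasurable"
      "measure lebesgue U < min \<delta> (e / (\<bar>C + e\<bar> + 1))"
      using null_set_open_cover[OF N(1)] \<open>\<delta> > 0\<close> \<open>e > 0\<close>
      by (metis abs_ge_zero add_nonneg_pos divide_pos_pos min_less_iff_conj zero_less_one)
    have "\<exists>d>0. \<forall>u\<in>{a..b}. \<forall>v\<in>{a..b}. u \<le> t \<and> t \<le> v \<and> \<bar>u - t\<bar> < d \<and> \<bar>v - t\<bar> < d
        \<longrightarrow> h v - h u \<le> (C + e) * (v - u)" if t: "t \<in> {a..b} - N" for t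
    proof -
      have "t \<in> {a..b} \<longrightarrow> (\<exists>D\<le>C. (h has_real_derivative D) (at t within {a..b}))"
        using N(2) t by auto
      then obtain D where "D \<le> C" "(h has_real_derivative D) (at t within {a..b})"
        using t by blast
      then show ?thesis
        using has_real_derivative_straddle \<open>e > 0\<close> by blast
    qed
    then obtain d where d: "\<And>t. t \<in> {a..b} - N \<Longrightarrow> d t > 0"
      "\<And>t u v. t \<in> {a..b} - N \<Longrightarrow> u \<in> {a..b} \<Longrightarrow> v \<in> {a..b} \<Longrightarrow> u \<le> t \<Longrightarrow> t \<le> v
        \<Longrightarrow> \<bar>u - t\<bar> < d t \<Longrightarrow> \<bar>v - t\<bar> < d t \<Longrightarrow> h v - h u \<le> (C + e) * (v - u)"
      by metis
    \<comment> \<open>Tags in \<open>N\<close> get \<open>U\<close>, the remaining tags their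
      straddle radius; \<open>UNIV\<close> is the default at points outside \<open>{a..b}\<close>,
      which are never tags.\<close>
    define \<gamma> where "\<gamma> t = (if t \<in> N then U else if t \<in> {a..b} then ball t (d t) else UNIV)" for t
    have "gauge \<gamma>"
      using U d(1) by (auto simp: \<gamma>_def gauge_def)
    then obtain p where p: "p tagged_division_of {a..b}" "\<gamma> fine p"
      using fine_division_exists_real by blast
    have finp: "finite p"
      using p(1) by (rule tagged_division_of_finite)
    have K: "\<exists>u v. K = {u..v} \<and> u \<le> t \<and> t \<le> v \<and> Inf K = u \<and> Sup K = v \<and> a \<le> u \<and> v \<le> b
        \<and> K \<subseteq> \<gamma> t" if tK: "(t, K) \<in> p" for t K
    proof -
      have "t \<in> K" "K \<subseteq> {a..b}" "K \<subseteq> \<gamma> t"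
        using p tK by (auto dest: tagged_division_ofD(2,3) fineD)
      moreover obtain u v where "K = cbox u v"
        using tagged_division_ofD(4)[OF p(1) tK] by blast
      ultimately show ?thesis
        by (intro exI[of _ u] exI[of _ v]) auto
    qed
    define incr where "incr z = h (Sup (snd z)) - h (Inf (snd z))" for z :: "real \<times> real set"
    define len where "len z = Sup (snd z) - Inf (snd z)" for z :: "real \<times> real set"
    define q where "q = {z \<in> p. fst z \<in> N}"
    have q: "finite q" "q \<subseteq> p"
      using finp by (auto simp: q_def)
    have len_nonneg: "0 \<le> len z" if "z \<in> p" for z
      using K[of "fst z" "snd z"] that by (auto simp: len_def)
    have good: "incr z \<le> (C + e) * len z" if "z \<in> p - q" for z
    proof -
      obtain t L where z0: "z = (t, L)"
        by (cases z)
      have z: "z = (t, L)" "t \<notin> N" "(t, L) \<in> p"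
        using that by (auto simp: q_def z0)
      obtain u v where L: "L = {u..v}" "u \<le> t" "t \<le> v" "Inf L = u" "Sup L = v" "a \<le> u" "v \<le> b"
        "L \<subseteq> \<gamma> t"
        using K[OF z(3)] by blast
      have "u \<in> L" "v \<in> L" "t \<in> {a..b}"
        using L by auto
      then have "u \<in> ball t (d t)" "v \<in> ball t (d t)"
        using L(8) z(2) by (auto simp: \<gamma>_def simp del: mem_ball)
      then show ?thesis
        using d(2)[of t u v] L z by (auto simp: incr_def len_def dist_real_def abs_minus_commute)
    qed
    have disj: "interior (snd z) \<inter> interior (snd w) = {}" if "z \<in> p" "w \<in> p" "z \<noteq> w" for z w
      using tagged_division_ofD(5)[OF p(1), of "fst z" "snd z" "fst w" "snd w"] that by auto
    have int_eq: "interior (snd z) = {Inf (snd z)<..<Sup (snd z)}" if "z \<in> p" for z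
    proof -
      have "snd z = {Inf (snd z)..Sup (snd z)}"
        using K[of "fst z" "snd z"] that by auto
      then show ?thesis
        using interior_atLeastAtMost_real by metis
    qed
    \<comment> \<open>The intervals with tags in \<open>N\<close> have disjoint interiors inside
      \<open>U\<close>, so their total length is at most the measure of \<open>U\<close>.\<close>
    have "(\<Sum>z\<in>q. len z) = (\<Sum>z\<in>q. measure lebesgue (interior (snd z)))"
      using q(2) len_nonneg by (intro sum.cong) (auto simp: len_def int_eq subset_eq)
    also have "\<dots> = measure lebesgue (\<Union>z\<in>q. interior (snd z))"
    proof (rule measure_finite_Union[symmetric])
      show "disjoint_family_on (\<lambda>z. interior (snd z)) q"
        unfolding disjoint_family_on_def using disj q(2) by blast
      show "emeasure lebesgue (interior (snd z)) \<noteq> \<infinity>" if "z \<in> q" for z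
      proof -
        have "z \<in> p"
          using that q(2) by blast
        then show ?thesis
          using len_nonneg[of z] by (simp add: int_eq len_def)
      qed
    qed (use q in auto)
    also have "\<dots> \<le> measure lebesgue U"
    proof (rule measure_mono_fmeasurable)
      have "interior (snd z) \<subseteq> U" if "z \<in> q" for z
      proof -
        have "snd z \<subseteq> \<gamma> (fst z)" "fst z \<in> N"
          using K[of "fst z" "snd z"] that by (auto simp: q_def)
        then show ?thesis
          using interior_subset[of "snd z"] by (auto simp: \<gamma>_def)
      qed
      then show "(\<Union>z\<in>q. interior (snd z)) \<subseteq> U"
        by blast
      show "(\<Union>z\<in>q. interior (snd z)) \<in> sets lebesgue"
        by (intro sets.finite_UN q(1)) auto
    qed (use U in auto)
    finally have len_q: "(\<Sum>z\<in>q. len z) < \<delta>" "(\<Sum>z\<in>q. len z) < e / (\<bar>C + e\<bar> + 1)"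
      using U by auto
    \<comment> \<open>Absolute continuity speaks of families indexed by an initial segment of the
      naturals, so \<open>q\<close> is enumerated.\<close>
    obtain f where f: "bij_betw f {..<card q} q"
      using ex_bij_betw_nat_finite[OF \<open>finite q\<close>] by (auto simp: atLeast0LessThan)
    have reindex: "(\<Sum>k<card q. g (f k)) = (\<Sum>z\<in>q. g z)" for g :: "real \<times> real set \<Rightarrow> real"
      using sum.reindex_bij_betw[OF f] .
    have fq: "f k \<in> p" if "k < card q" for k
      using f q that by (auto simp: bij_betw_def)
    have "(\<Sum>k<card q. \<bar>h (Sup (snd (f k))) - h (Inf (snd (f k)))\<bar>) < e"
    proof (rule \<delta>, intro conjI)
      show "\<forall>k<card q. a \<le> Inf (snd (f k)) \<and> Inf (snd (f k)) \<le> Sup (snd (f k)) \<and> Sup (snd (f k)) \<le> b"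
      proof (intro allI impI)
        fix k assume "k < card q"
        then show "a \<le> Inf (snd (f k)) \<and> Inf (snd (f k)) \<le> Sup (snd (f k)) \<and> Sup (snd (f k)) \<le> b"
          using K[of "fst (f k)" "snd (f k)"] fq by auto
      qed
      show "\<forall>k<card q. \<forall>l<card q. k \<noteq> l \<longrightarrow>
          {Inf (snd (f k))<..<Sup (snd (f k))} \<inter> {Inf (snd (f l))<..<Sup (snd (f l))} = {}"
      proof (intro allI impI)
        fix k l assume kl: "k < card q" "l < card q" "k \<noteq> l"
        then have "f k \<noteq> f l"
          using f by (auto simp: bij_betw_def inj_on_def)
        then show "{Inf (snd (f k))<..<Sup (snd (f k))} \<inter> {Inf (snd (f l))<..<Sup (snd (f l))} = {}"
          using disj[of "f k" "f l"] int_eq fq kl by simp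
      qed
      show "(\<Sum>k<card q. Sup (snd (f k)) - Inf (snd (f k))) < \<delta>"
        using len_q(1) reindex[of len] by (simp add: len_def)
    qed
    then have incr_q: "(\<Sum>z\<in>q. \<bar>incr z\<bar>) < e"
      using reindex[of "\<lambda>z. \<bar>incr z\<bar>"] by (simp add: incr_def)
    have len_p: "(\<Sum>z\<in>p. len z) = b - a"
      using additive_tagged_division_1[OF \<open>a \<le> b\<close> p(1), of "\<lambda>x. x"] by (simp add: len_def case_prod_unfold)
    have "h b - h a = (\<Sum>z\<in>p. incr z)"
      using additive_tagged_division_1[OF \<open>a \<le> b\<close> p(1), of h] by (simp add: incr_def case_prod_unfold)
    also have "\<dots> = (\<Sum>z\<in>p - q. incr z) + (\<Sum>z\<in>q. incr z)"
      using sum.subset_diff[OF q(2) finp] .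
    also have "\<dots> \<le> (\<Sum>z\<in>p - q. (C + e) * len z) + (\<Sum>z\<in>q. \<bar>incr z\<bar>)"
      by (intro add_mono sum_mono good) auto
    finally have "h b - h a \<le> (C + e) * (\<Sum>z\<in>p - q. len z) + e"
      using incr_q by (simp add: sum_distrib_left)
    also have "(\<Sum>z\<in>p - q. len z) = b - a - (\<Sum>z\<in>q. len z)"
      using sum.subset_diff[OF q(2) finp, of len] len_p by simp
    \<comment> \<open>The sign of \<open>C + e\<close> is unknown, so the removed length is
      estimated with \<open>\<bar>C + e\<bar>\<close>; by the choice of \<open>U\<close> it costs at
      most \<open>e\<close>.\<close>
    also have "(C + e) * (b - a - (\<Sum>z\<in>q. len z)) \<le> (C + e) * (b - a) + e"
    proof -
      have "0 \<le> (\<Sum>z\<in>q. len z)"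
        using q len_nonneg by (intro sum_nonneg) auto
      then have "- ((C + e) * (\<Sum>z\<in>q. len z)) \<le> \<bar>C + e\<bar> * (\<Sum>z\<in>q. len z)"
        using abs_ge_minus_self[of "(C + e) * (\<Sum>z\<in>q. len z)"] by (simp add: abs_mult)
      also have "\<dots> \<le> (\<bar>C + e\<bar> + 1) * (\<Sum>z\<in>q. len z)"
        using \<open>0 \<le> (\<Sum>z\<in>q. len z)\<close> by (intro mult_right_mono) auto
      also have "\<dots> \<le> e"
        using len_q(2) by (simp add: field_simps)
      finally show ?thesis
        by (simp add: right_diff_distrib)
    qed
    finally show ?thesis
      by (simp add: algebra_simps)
  qed
  show ?thesis
  proof (rule field_le_epsilon)
    fix e :: real assume "e > 0"
    then have "h b - h a \<le> C * (b - a) + e / (b - a + 2) * (b - a + 2)"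
      using \<open>a \<le> b\<close> by (intro main) auto
    then show "h b - h a \<le> C * (b - a) + e"
      using \<open>a \<le> b\<close> by simp
  qed
qed

text \<open>With a slope \<open>e\<close> to spare, the set \<open>S\<close> of times
  \<open>t\<close> from which the increment up to \<open>b\<close> is at most
  \<open>e * (b - t)\<close> is closed. If its infimum were above \<open>a\<close>, the left Dini
  bound there would produce a smaller member.\<close>

lemma nonincreasing_of_left_Dini:
  fixes g :: "real \<Rightarrow> real"
  assumes "a \<le> b" and cont: "continuous_on {a..b} g"
    and Dini: "\<And>t e. a < t \<Longrightarrow> t \<le> b \<Longrightarrow> e > 0 \<Longrightarrow> \<exists>d>0. \<forall>s. a \<le> s \<and> t - d < s \<and> s < t
      \<longrightarrow> g t - g s \<le> e * (t - s)"
  shows "g b \<le> g a"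
proof -
  have main: "g b - g a \<le> e * (b - a)" if "e > 0" for e
  proof -
    define S where "S = {t \<in> {a..b}. g b - g t \<le> e * (b - t)}"
    have "closed ({a..b} \<inter> (\<lambda>t. g b - g t - e * (b - t)) -` {..0})"
      by (intro continuous_closed_preimage continuous_intros cont)
    also have "{a..b} \<inter> (\<lambda>t. g b - g t - e * (b - t)) -` {..0} = S"
      by (auto simp: S_def)
    finally have "closed S" .
    moreover have "b \<in> S" "bdd_below S"
      using \<open>a \<le> b\<close> by (auto simp: S_def intro: bdd_belowI[of _ a])
    ultimately have "Inf S \<in> S"
      using closed_contains_Inf by blast
    have "Inf S = a"
    proof (rule ccontr)
      assume "Inf S \<noteq> a"
      then have *: "a < Inf S" "Inf S \<le> b" "g b - g (Inf S) \<le> e * (b - Inf S)"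
        using \<open>Inf S \<in> S\<close> by (auto simp: S_def)
      then obtain d where "d > 0" and d: "\<And>s. a \<le> s \<Longrightarrow> Inf S - d < s \<Longrightarrow> s < Inf S
          \<Longrightarrow> g (Inf S) - g s \<le> e * (Inf S - s)"
        using Dini[OF _ _ \<open>e > 0\<close>] by blast
      define s where "s = max a (Inf S - d / 2)"
      have s: "a \<le> s" "Inf S - d < s" "s < Inf S"
        using * \<open>d > 0\<close> by (auto simp: s_def)
      then have "s \<in> S"
        using d[OF s] * by (simp add: S_def algebra_simps)
      then show False
        using cInf_lower[OF _ \<open>bdd_below S\<close>] s by fastforce
    qed
    then show ?thesis
      using \<open>Inf S \<in> S\<close> by (simp add: S_def)
  qed
  show ?thesis
  proof (rule field_le_epsilon)
    fix e :: real assume "e > 0"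
    then have "g b - g a \<le> e / (b - a + 1) * (b - a)"
      using \<open>a \<le> b\<close> by (intro main) auto
    also have "\<dots> \<le> e"
      using \<open>a \<le> b\<close> \<open>e > 0\<close> by (simp add: field_simps)
    finally show "g b \<le> g a + e"
      by simp
  qed
qed

section \<open>The metric on gradients of the first variation\<close>

lemma is_chartD:
  assumes "is_chart c"
  shows "open (dom_of c)" "open (img c)" "continuous_on (dom_of c) (crd c)"
    "continuous_on (img c) (cinv c)"
    "p \<in> dom_of c \<Longrightarrow> cinv c (crd c p) = p" "p \<in> dom_of c \<Longrightarrow> crd c p \<in> img c"
    "y \<in> img c \<Longrightarrow> cinv c y \<in> dom_of c" "y \<in> img c \<Longrightarrow> crd c (cinv c y) = y"
  using assms unfolding is_chart_def homeomorphism_def img_def by auto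

section \<open>Inverses of positive definite matrices and their continuity\<close>

lemma matrix_inv_right:
  fixes M :: "real ^ 'n ^ 'n"
  assumes "det M \<noteq> 0"
  shows "M ** matrix_inv M = mat 1"
  using assms someI_ex[of "\<lambda>B. M ** B = mat 1 \<and> B ** M = mat 1"]
  unfolding matrix_inv_def invertible_det_nz[symmetric] invertible_def by blast

text \<open>The Cramer formula makes the entries of the inverse continuous functions of the matrix.\<close>

lemma matrix_inv_entry:
  fixes M :: "real ^ 'n ^ 'n"
  assumes "det M \<noteq> 0"
  shows "matrix_inv M $ i $ j = det (\<chi> k l. if l = i then axis j 1 $ k else M $ k $ l) / det M"
proof -
  have "M *v (matrix_inv M *v axis j 1) = axis j 1"
    by (simp add: matrix_vector_mul_assoc matrix_inv_right[OF assms])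
  then have "matrix_inv M *v axis j 1 = (\<chi> i. det (\<chi> k l. if l = i then axis j 1 $ k else M $ k $ l) / det M)"
    by (subst (asm) cramer[OF assms])
  then have "(matrix_inv M *v axis j 1) $ i = det (\<chi> k l. if l = i then axis j 1 $ k else M $ k $ l) / det M"
    by simp
  then show ?thesis
    by (simp add: matrix_vector_mult_basis column_def)
qed

lemma continuous_on_det:
  fixes M :: "'a::topological_space \<Rightarrow> real ^ 'n ^ 'n"
  assumes "\<And>i j. continuous_on S (\<lambda>x. M x $ i $ j)"
  shows "continuous_on S (\<lambda>x. det (M x))"
  unfolding det_def by (intro continuous_on_sum continuous_on_mult continuous_on_const continuous_on_prod assms)

lemma continuous_on_matrix_inv_entry:
  fixes M :: "'a::topological_space \<Rightarrow> real ^ 'n ^ 'n"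
  assumes M: "\<And>i j. continuous_on S (\<lambda>x. M x $ i $ j)" and det: "\<And>x. x \<in> S \<Longrightarrow> det (M x) \<noteq> 0"
  shows "continuous_on S (\<lambda>x. matrix_inv (M x) $ i $ j)"
proof -
  have "continuous_on S (\<lambda>x. (\<chi> k l. if l = i then axis j 1 $ k else M x $ k $ l) $ k $ l)" for k l
    using M by (cases "l = i") (auto intro: continuous_on_const)
  then have "continuous_on S (\<lambda>x. det (\<chi> k l. if l = i then axis j 1 $ k else M x $ k $ l) / det (M x))"
    by (intro continuous_on_divide continuous_on_det M) (auto simp: det)
  then show ?thesis
    by (rule continuous_on_eq) (simp add: matrix_inv_entry det)
qed

lemma posdef_det_nz:
  fixes M :: "real ^ 'n ^ 'n"
  assumes "\<And>v. v \<noteq> 0 \<Longrightarrow> v \<bullet> (M *v v) > 0"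
  shows "det M \<noteq> 0"
proof -
  have "v = 0" if "M *v v = 0" for v
    using assms[of v] that by fastforce
  then show ?thesis
    unfolding invertible_det_nz[symmetric] invertible_left_inverse matrix_left_invertible_ker by blast
qed

text \<open>Finite subcover; the sum of the absolute local constants dominates each of them, and the
  added \<open>1\<close> makes it positive. The predicate \<open>Q\<close> leaves room for further
  quantifiers below the constant.\<close>

lemma uniform_bound_of_local_bounds:
  fixes Q :: "'a::topological_space \<Rightarrow> real \<Rightarrow> bool"
  assumes "compact (UNIV :: 'a set)" and loc: "\<And>p. \<exists>U C. open U \<and> p \<in> U \<and> (\<forall>q\<in>U. Q q C)"
    and mono: "\<And>p C C'. Q p C \<Longrightarrow> C \<le> C' \<Longrightarrow> Q p C'"
  shows "\<exists>C>0. \<forall>p. Q p C"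
proof -
  obtain U C where U: "\<And>p. open (U p)" "\<And>p. p \<in> U p" "\<And>p q. q \<in> U p \<Longrightarrow> Q q (C p)"
    using loc by metis
  have cover: "UNIV \<subseteq> (\<Union>p\<in>UNIV. U p)"
    using U(2) by auto
  obtain I where I: "finite I" "UNIV \<subseteq> (\<Union>p\<in>I. U p)"
    using compactE_image[OF assms(1) U(1) cover] by metis
  have "Q p ((\<Sum>i\<in>I. \<bar>C i\<bar>) + 1)" for p
  proof -
    obtain i where i: "i \<in> I" "p \<in> U i"
      using I(2) by blast
    have "\<bar>C i\<bar> \<le> (\<Sum>i\<in>I. \<bar>C i\<bar>)"
      using i I(1) by (intro member_le_sum) auto
    then show ?thesis
      using mono[OF U(3)[OF i(2)]] by auto
  qed
  moreover have "0 < (\<Sum>i\<in>I. \<bar>C i\<bar>) + 1"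
    by (intro add_nonneg_pos sum_nonneg) auto
  ultimately show ?thesis
    by blast
qed

locale smooth_objective =
  fixes A :: "('m::t2_space, 'd::finite) chart set"
    and G :: "('m, 'd) metric_tensor"
    and \<phi> :: "'m \<Rightarrow> 'f::{real_inner,complete_space}"
    and R :: "'f \<Rightarrow> real"
    and lam :: real
  assumes smooth: "smoothness_assumption A G \<phi> R lam"
begin

lemma compact_UNIV: "compact (UNIV :: 'm set)"
  and lam_pos: "lam > 0"
  and R_nonneg: "R f \<ge> 0"
  and bounded_grad_sublevel: "bounded (grad R ` {f. R f \<le> a})"
  and manifold: "riemannian_manifold A G"
  using smooth by (auto simp: smoothness_assumption_def)

lemma GDERIV_R: "GDERIV R f :> grad R f"
  and continuous_on_grad_R: "continuous_on UNIV (grad R)"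
proof -
  obtain D1 D2 where D: "\<And>f. (R has_derivative blinfun_apply (D1 f)) (at f)"
    "\<And>f. (D1 has_derivative blinfun_apply (D2 f)) (at f)"
    using smooth unfolding smoothness_assumption_def twice_frechet_loc_lipschitz_def by blast
  show "GDERIV R f :> grad R f"
    by (rule GDERIV_grad[OF D(1)])
  have "continuous_on UNIV D1"
    using D(2) by (meson continuous_at_imp_continuous_on has_derivative_continuous)
  then show "continuous_on UNIV (grad R)"
    using continuous_on_grad[OF D(1)] by blast
qed

lemma continuous_on_R: "continuous_on UNIV R"
  by (rule continuous_at_imp_continuous_on)
    (intro ballI has_derivative_continuous[OF GDERIV_R[unfolded gderiv_def]])

lemma charts:
  assumes "c \<in> A"
  shows "is_chart c"
    and "\<And>y v. y \<in> img c \<Longrightarrow> v \<noteq> 0 \<Longrightarrow> v \<bullet> (G c y *v v) > 0"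
    and "\<And>y. y \<in> img c \<Longrightarrow> transpose (G c y) = G c y"
    and "continuous_on (img c) (G c)"
proof -
  show "is_chart c"
    using assms manifold unfolding riemannian_manifold_def smooth_structure_def by blast
  show "\<And>y v. y \<in> img c \<Longrightarrow> v \<noteq> 0 \<Longrightarrow> v \<bullet> (G c y *v v) > 0"
    and "\<And>y. y \<in> img c \<Longrightarrow> transpose (G c y) = G c y"
    using assms manifold unfolding riemannian_manifold_def by blast+
  have "smooth_on (G c) (img c)"
    using assms manifold unfolding riemannian_manifold_def by blast
  then show "continuous_on (img c) (G c)"
    unfolding smooth_on_def by (metis Ck_on.simps(1))
qed

lemma chart_at: "\<exists>c. c \<in> A \<and> p \<in> dom_of c"
  using manifold unfolding riemannian_manifold_def smooth_structure_def by blast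

lemma det_metric: "c \<in> A \<Longrightarrow> y \<in> img c \<Longrightarrow> det (G c y) \<noteq> 0"
  using charts(2) posdef_det_nz by blast

lemma phi_deriv:
  assumes "c \<in> A"
  shows "y \<in> img c \<Longrightarrow>
      ((\<phi> \<circ> cinv c) has_derivative frechet_derivative (\<phi> \<circ> cinv c) (at y)) (at y)"
    and "continuous_on (img c) (\<lambda>y. frechet_derivative (\<phi> \<circ> cinv c) (at y) v)"
proof -
  obtain D1 D2 where D: "\<And>y. y \<in> img c \<Longrightarrow> ((\<phi> \<circ> cinv c) has_derivative blinfun_apply (D1 y)) (at y)"
    "\<And>y. y \<in> img c \<Longrightarrow> (D1 has_derivative blinfun_apply (D2 y)) (at y)"
    using smooth assms unfolding smoothness_assumption_def twice_frechet_loc_lipschitz_def by blast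
  then show "y \<in> img c \<Longrightarrow>
      ((\<phi> \<circ> cinv c) has_derivative frechet_derivative (\<phi> \<circ> cinv c) (at y)) (at y)"
    using frechet_derivative_works differentiableI by blast
  have "continuous_on (img c) D1"
    using D(2) by (meson continuous_at_imp_continuous_on has_derivative_continuous)
  then have "continuous_on (img c) (\<lambda>y. blinfun_apply (D1 y) v)"
    by (intro continuous_intros)
  then show "continuous_on (img c) (\<lambda>y. frechet_derivative (\<phi> \<circ> cinv c) (at y) v)"
    by (rule continuous_on_eq) (simp add: frechet_derivative_at[OF D(1), symmetric])
qed

lemma continuous_on_phi: "continuous_on UNIV \<phi>"
proof (rule continuous_at_imp_continuous_on, rule ballI)
  fix p
  obtain c where c: "c \<in> A" "p \<in> dom_of c"
    using chart_at by blast
  have "continuous_on (img c) (\<phi> \<circ> cinv c)"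
    using phi_deriv(1)[OF c(1)] by (meson continuous_at_imp_continuous_on has_derivative_continuous)
  then have "continuous_on (dom_of c) ((\<phi> \<circ> cinv c) \<circ> crd c)"
    unfolding img_def by (rule continuous_on_compose[OF is_chartD(3)[OF charts(1)[OF c(1)]]])
  then have "continuous_on (dom_of c) \<phi>"
    by (rule continuous_on_eq) (simp add: is_chartD(5)[OF charts(1)[OF c(1)]])
  then show "isCont \<phi> p"
    using c is_chartD(1)[OF charts(1)[OF c(1)]] continuous_on_eq_continuous_at by blast
qed

lemma phi_bounded: "\<exists>C>0. \<forall>p. norm (\<phi> p) \<le> C"
  using compact_imp_bounded[OF compact_continuous_image[OF continuous_on_phi compact_UNIV]]
  by (auto simp: bounded_pos)

section \<open>Test functions affine in the feature map\<close>

definition test :: "'f \<Rightarrow> real \<Rightarrow> 'm \<Rightarrow> real" where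
  "test v k p = \<phi> p \<bullet> v + k"

text \<open>The components in the chart \<open>c\<close> of the differential at \<open>p\<close> of
  the scalar function \<open>\<phi> \<bullet> v\<close>: a covector, to be raised by the inverse
  metric.\<close>

definition dcoord :: "('m, 'd) chart \<Rightarrow> 'm \<Rightarrow> 'f \<Rightarrow> real ^ 'd" where
  "dcoord c p v = (\<chi> j. pd j (\<phi> \<circ> cinv c) (crd c p) \<bullet> v)"

text \<open>First variations are members of the family \<open>test\<close>, hence admissible test
  functions. The family also contains the constant \<open>1\<close>, which measures mass, and the
  functions \<open>\<phi> \<bullet> v\<close>, which probe the integral of
  \<open>\<phi>\<close>.\<close>

lemma J'_eq_test: "J' \<phi> R lam \<mu> = test (grad R (bochner_int \<mu> \<phi>)) lam"
  by (simp add: J'_def test_def fun_eq_iff)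

lemma continuous_on_test: "continuous_on UNIV (test v k)"
  unfolding test_def[abs_def] by (intro continuous_intros continuous_on_phi)

lemma test_deriv:
  assumes "c \<in> A" "y \<in> img c"
  shows "((test v k \<circ> cinv c) has_derivative (\<lambda>h. frechet_derivative (\<phi> \<circ> cinv c) (at y) h \<bullet> v)) (at y)"
proof -
  have "test v k \<circ> cinv c = (\<lambda>z. (\<phi> \<circ> cinv c) z \<bullet> v + k)"
    by (auto simp: test_def)
  then show ?thesis
    using has_derivative_inner_left[OF phi_deriv(1)[OF assms], of v]
    by (auto intro: has_derivative_add_const)
qed

lemma C1_test: "C1_function A (test v k)"
  unfolding C1_function_def
proof
  fix c assume c: "c \<in> A"
  have "continuous_on (img c) (\<lambda>y. frechet_derivative (\<phi> \<circ> cinv c) (at y) h \<bullet> v)" for h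
    by (intro continuous_intros phi_deriv(2) c)
  then have "continuous_on (img c) (\<lambda>y. frechet_derivative (test v k \<circ> cinv c) (at y) h)" for h
    by (rule continuous_on_eq) (simp add: frechet_derivative_at[OF test_deriv[OF c], symmetric])
  then show "Ck_on 1 (test v k \<circ> cinv c) (img c)"
    using test_deriv[OF c] differentiableI by (simp add: One_nat_def) blast
qed

section \<open>Coordinate formulas and change of chart\<close>

lemma grad_vec_test:
  assumes "c \<in> A" "p \<in> dom_of c"
  shows "grad_vec G (test v k) p c = matrix_inv (G c (crd c p)) *v dcoord c p v"
proof -
  have "crd c p \<in> img c"
    using assms by (simp add: img_def)
  then show ?thesis
    unfolding grad_vec_def dcoord_def pd_def
    by (simp add: frechet_derivative_at[OF test_deriv[OF assms(1)], symmetric])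
qed

lemma dcoord_inner:
  assumes "c \<in> A" "p \<in> dom_of c"
  shows "dcoord c p v \<bullet> w = frechet_derivative (\<phi> \<circ> cinv c) (at (crd c p)) w \<bullet> v"
proof -
  define F where "F = frechet_derivative (\<phi> \<circ> cinv c) (at (crd c p))"
  have "linear F"
    using phi_deriv(1)[OF assms(1), of "crd c p"] assms(2)
    by (auto simp: F_def img_def intro: has_derivative_linear)
  have "F w = F (\<Sum>j\<in>UNIV. w $ j *\<^sub>R axis j 1)"
    using basis_expansion[of w] by (simp add: scalar_mult_eq_scaleR)
  also have "\<dots> = (\<Sum>j\<in>UNIV. w $ j *\<^sub>R F (axis j 1))"
    using \<open>linear F\<close> by (simp add: linear_sum linear_scale)
  finally have "F w \<bullet> v = (\<Sum>j\<in>UNIV. w $ j * (F (axis j 1) \<bullet> v))"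
    by (simp add: inner_sum_left)
  then show ?thesis
    by (simp add: dcoord_def pd_def inner_vec_def F_def mult.commute)
qed

text \<open>The third claim is the chain rule for \<open>\<phi>\<close> in two charts. Surjectivity
  of \<open>D\<close> comes from the metric: a vector with \<open>D v = 0\<close> has length zero,
  so \<open>D\<close> is injective between spaces of equal dimension.\<close>

lemma transition:
  assumes "c \<in> A" "c' \<in> A" "p \<in> dom_of c" "p \<in> dom_of c'"
  defines "D \<equiv> frechet_derivative (crd c' \<circ> cinv c) (at (crd c p))"
  shows "surj D"
    and "v \<bullet> (G c (crd c p) *v w) = D v \<bullet> (G c' (crd c' p) *v D w)"
    and "dcoord c p u \<bullet> w = dcoord c' p u \<bullet> D w"
proof -
  define W where "W = crd c ` (dom_of c \<inter> dom_of c')"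
  have chart: "is_chart c" "is_chart c'"
    using charts(1) assms by auto
  have "W = img c \<inter> cinv c -` dom_of c'"
    using is_chartD(5)[OF chart(1)] by (auto simp: W_def img_def)
  then have "open W"
    using continuous_open_preimage[OF is_chartD(4,2)[OF chart(1)] is_chartD(1)[OF chart(2)]] by simp
  have "compatible c c'"
    using assms(1,2) manifold unfolding riemannian_manifold_def smooth_structure_def by blast
  then have "Ck_on 1 (crd c' \<circ> cinv c) W"
    unfolding compatible_def smooth_on_def W_def by blast
  moreover have pW: "crd c p \<in> W"
    using assms by (auto simp: W_def)
  ultimately have D: "((crd c' \<circ> cinv c) has_derivative D) (at (crd c p))"
    by (simp add: One_nat_def D_def frechet_derivative_works[symmetric])
  show metric: "v \<bullet> (G c (crd c p) *v w) = D v \<bullet> (G c' (crd c' p) *v D w)" for v w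
    using manifold assms(1-4) unfolding riemannian_manifold_def Let_def D_def by blast
  have img: "crd c p \<in> img c" "crd c' p \<in> img c'"
    using assms by (auto simp: img_def)
  have "v = 0" if "D v = 0" for v
    using metric[of v v] charts(2)[OF assms(1) img(1), of v] that by fastforce
  then have "inj D"
    using has_derivative_linear[OF D] by (simp add: linear_injective_0)
  then show "surj D"
    using has_derivative_linear[OF D] linear_injective_imp_surjective by blast
  have "((\<phi> \<circ> cinv c') \<circ> (crd c' \<circ> cinv c) has_derivative
      (frechet_derivative (\<phi> \<circ> cinv c') (at (crd c' p)) \<circ> D)) (at (crd c p))"
  proof (rule diff_chain_at[OF D])
    show "(\<phi> \<circ> cinv c' has_derivative frechet_derivative (\<phi> \<circ> cinv c') (at (crd c' p)))
        (at ((crd c' \<circ> cinv c) (crd c p)))"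
      using phi_deriv(1)[OF assms(2) img(2)] is_chartD(5)[OF chart(1) assms(3)] by simp
  qed
  then have "((\<phi> \<circ> cinv c) has_derivative
      (frechet_derivative (\<phi> \<circ> cinv c') (at (crd c' p)) \<circ> D)) (at (crd c p))"
  proof (rule has_derivative_transform_within_open[OF _ \<open>open W\<close> pW])
    fix y assume "y \<in> W"
    then show "((\<phi> \<circ> cinv c') \<circ> (crd c' \<circ> cinv c)) y = (\<phi> \<circ> cinv c) y"
      using is_chartD(5)[OF chart(1)] is_chartD(5)[OF chart(2)] by (auto simp: W_def)
  qed
  then have "frechet_derivative (\<phi> \<circ> cinv c) (at (crd c p)) w
      = frechet_derivative (\<phi> \<circ> cinv c') (at (crd c' p)) (D w)"
    using fun_cong[OF has_derivative_unique[OF phi_deriv(1)[OF assms(1) img(1)]], of _ w] by simp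
  then show "dcoord c p u \<bullet> w = dcoord c' p u \<bullet> D w"
    using assms by (simp add: dcoord_inner)
qed

lemma matrix_inv_metric:
  assumes "c \<in> A" "p \<in> dom_of c"
  shows "G c (crd c p) *v z = b \<longleftrightarrow> z = matrix_inv (G c (crd c p)) *v b"
proof -
  define M where "M = G c (crd c p)"
  have "det M \<noteq> 0"
    unfolding M_def using assms by (intro det_metric) (auto simp: img_def)
  then have "M ** matrix_inv M = mat 1" "matrix_inv M ** M = mat 1"
    using matrix_inv_right[of M] matrix_left_right_inverse[of M "matrix_inv M"] by auto
  then show ?thesis
    unfolding M_def[symmetric] by (auto simp: matrix_vector_mul_assoc)
qed

text \<open>\<open>riem_inner\<close> uses a chart chosen separately at each point. Continuity in
  \<open>p\<close> and local bounds require the formula in one chart kept fixed near a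
  point.\<close>

lemma riem_inner_test:
  assumes c: "c \<in> A" "p \<in> dom_of c"
  shows "riem_inner A G p (grad_vec G (test v k) p) (grad_vec G (test w l) p)
    = (matrix_inv (G c (crd c p)) *v dcoord c p v) \<bullet> dcoord c p w"
proof -
  define c' where "c' = (SOME c. c \<in> A \<and> p \<in> dom_of c)"
  have c': "c' \<in> A" "p \<in> dom_of c'"
    using someI_ex[OF chart_at[of p]] by (auto simp: c'_def)
  define D where "D = frechet_derivative (crd c' \<circ> cinv c) (at (crd c p))"
  note tr = transition[OF c(1) c'(1) c(2) c'(2), folded D_def]
  define X where "X u = matrix_inv (G c (crd c p)) *v dcoord c p u" for u
  define X' where "X' u = matrix_inv (G c' (crd c' p)) *v dcoord c' p u" for u
  have GX: "G c (crd c p) *v X u = dcoord c p u" for u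
    using matrix_inv_metric[OF c] by (simp add: X_def)
  have sym: "a \<bullet> (G c (crd c p) *v b) = (G c (crd c p) *v a) \<bullet> b" for a b
    using dot_lmul_matrix[of a "G c (crd c p)" b] transpose_matrix_vector[of "G c (crd c p)" a]
      charts(3)[OF c(1) is_chartD(6)[OF charts(1)[OF c(1)] c(2)]] by simp
  have sym': "a \<bullet> (G c' (crd c' p) *v b) = (G c' (crd c' p) *v a) \<bullet> b" for a b
    using dot_lmul_matrix[of a "G c' (crd c' p)" b] transpose_matrix_vector[of "G c' (crd c' p)" a]
      charts(3)[OF c'(1) is_chartD(6)[OF charts(1)[OF c'(1)] c'(2)]] by simp
  \<comment> \<open>The gradient transforms as a vector: its metric pairing with every
    \<open>D z\<close> is prescribed by the differential, and by surjectivity these directions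
    exhaust the space.\<close>
  have "D (X u) = X' u" for u
  proof -
    have "(G c' (crd c' p) *v D (X u)) \<bullet> D z = dcoord c' p u \<bullet> D z" for z
      unfolding sym'[symmetric] tr(2)[symmetric] tr(3)[symmetric] sym GX ..
    then have "(G c' (crd c' p) *v D (X u)) \<bullet> z = dcoord c' p u \<bullet> z" for z
      using surjD[OF tr(1), of z] by auto
    then have "G c' (crd c' p) *v D (X u) = dcoord c' p u"
      using vector_eq_rdot by blast
    then show ?thesis
      using matrix_inv_metric[OF c'] by (simp add: X'_def)
  qed
  then have "X' v \<bullet> (G c' (crd c' p) *v X' w) = X v \<bullet> dcoord c p w"
    using tr(2)[of "X v" "X w"] GX by simp
  then show ?thesis
    unfolding riem_inner_def Let_def c'_def[symmetric]
    by (simp add: grad_vec_test[OF c'] X_def X'_def)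
qed

section \<open>The inner product of gradients as a bilinear form in the features\<close>

definition grad_inner :: "'m \<Rightarrow> 'f \<Rightarrow> 'f \<Rightarrow> real" where
  "grad_inner p v w = riem_inner A G p (grad_vec G (test v 0) p) (grad_vec G (test w 0) p)"

text \<open>Additive constants have no gradient, so the pairing depends on the vectors
  \<open>v\<close> and \<open>w\<close> only.\<close>

lemma riem_inner_test_eq:
  "riem_inner A G p (grad_vec G (test v k) p) (grad_vec G (test w l) p) = grad_inner p v w"
  using chart_at[of p] riem_inner_test by (auto simp: grad_inner_def)

lemma grad_inner_coord:
  assumes "c \<in> A" "p \<in> dom_of c"
  shows "grad_inner p v w = (\<Sum>i\<in>UNIV. \<Sum>j\<in>UNIV. matrix_inv (G c (crd c p)) $ i $ j
    * (pd j (\<phi> \<circ> cinv c) (crd c p) \<bullet> v) * (pd i (\<phi> \<circ> cinv c) (crd c p) \<bullet> w))"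
  unfolding grad_inner_def riem_inner_test[OF assms]
  by (simp add: inner_vec_def matrix_vector_mult_def dcoord_def sum_distrib_right)

lemma grad_inner_nonneg: "grad_inner p v v \<ge> 0"
proof -
  obtain c where c: "c \<in> A" "p \<in> dom_of c"
    using chart_at by blast
  define X where "X = matrix_inv (G c (crd c p)) *v dcoord c p v"
  have "G c (crd c p) *v X = dcoord c p v"
    using matrix_inv_metric[OF c] by (simp add: X_def)
  then have "grad_inner p v v = X \<bullet> (G c (crd c p) *v X)"
    unfolding grad_inner_def riem_inner_test[OF c] by (simp add: X_def)
  then show ?thesis
    using charts(2)[OF c(1) is_chartD(6)[OF charts(1)[OF c(1)] c(2)], of X]
    by (cases "X = 0") auto
qed

lemma grad_inner_diff_left: "grad_inner p (v - v') w = grad_inner p v w - grad_inner p v' w"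
proof -
  obtain c where "c \<in> A" "p \<in> dom_of c"
    using chart_at by blast
  then show ?thesis
    by (simp add: grad_inner_coord inner_diff_right algebra_simps sum_subtractf)
qed

lemma continuous_on_coord:
  assumes c: "c \<in> A"
  shows "continuous_on (dom_of c) (\<lambda>p. matrix_inv (G c (crd c p)) $ i $ j)"
    and "continuous_on (dom_of c) (\<lambda>p. pd j (\<phi> \<circ> cinv c) (crd c p))"
proof -
  note crd = is_chartD(3)[OF charts(1)[OF c]]
  have "continuous_on (img c) (\<lambda>y. matrix_inv (G c y) $ i $ j)"
    by (rule continuous_on_matrix_inv_entry) (intro continuous_intros charts(4) c, rule det_metric[OF c])
  then show "continuous_on (dom_of c) (\<lambda>p. matrix_inv (G c (crd c p)) $ i $ j)"
    by (rule continuous_on_compose2[OF _ crd]) (simp add: img_def)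
  show "continuous_on (dom_of c) (\<lambda>p. pd j (\<phi> \<circ> cinv c) (crd c p))"
    unfolding pd_def
    by (rule continuous_on_compose2[OF phi_deriv(2)[OF c] crd]) (simp add: img_def)
qed

lemma continuous_on_grad_inner: "continuous_on UNIV (\<lambda>p. grad_inner p v w)"
proof (rule continuous_at_imp_continuous_on, rule ballI)
  fix p
  obtain c where c: "c \<in> A" "p \<in> dom_of c"
    using chart_at by blast
  have "continuous_on (dom_of c) (\<lambda>p. \<Sum>i\<in>UNIV. \<Sum>j\<in>UNIV. matrix_inv (G c (crd c p)) $ i $ j
      * (pd j (\<phi> \<circ> cinv c) (crd c p) \<bullet> v) * (pd i (\<phi> \<circ> cinv c) (crd c p) \<bullet> w))"
    by (intro continuous_on_sum continuous_on_mult continuous_on_inner continuous_on_const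
        continuous_on_coord c)
  then have "continuous_on (dom_of c) (\<lambda>p. grad_inner p v w)"
    by (rule continuous_on_eq) (simp add: grad_inner_coord[OF c(1)])
  then show "isCont (\<lambda>p. grad_inner p v w) p"
    using c is_chartD(1)[OF charts(1)[OF c(1)]] continuous_on_eq_continuous_at by blast
qed

text \<open>In a chart, Cauchy-Schwarz in each term of the coordinate formula gives a bound by a
  continuous function \<open>k\<close> of the point. It stays below \<open>k p + 1\<close> near
  \<open>p\<close>, and compactness makes the constant uniform.\<close>

lemma grad_inner_bounded: "\<exists>C>0. \<forall>p v w. \<bar>grad_inner p v w\<bar> \<le> C * norm v * norm w"
proof (rule uniform_bound_of_local_bounds[OF compact_UNIV])
  show "\<exists>U C. open U \<and> p \<in> U \<and> (\<forall>q\<in>U. \<forall>v w. \<bar>grad_inner q v w\<bar> \<le> C * norm v * norm w)" for p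
  proof -
    obtain c where c: "c \<in> A" "p \<in> dom_of c"
      using chart_at by blast
    define k where "k q = (\<Sum>i\<in>UNIV. \<Sum>j\<in>UNIV. \<bar>matrix_inv (G c (crd c q)) $ i $ j\<bar>
      * norm (pd j (\<phi> \<circ> cinv c) (crd c q)) * norm (pd i (\<phi> \<circ> cinv c) (crd c q)))" for q
    have "continuous_on (dom_of c) k"
      unfolding k_def
      by (intro continuous_on_sum continuous_on_mult continuous_on_norm continuous_on_rabs
          continuous_on_coord c)
    moreover have opn: "open (dom_of c)"
      by (rule is_chartD(1)[OF charts(1)[OF c(1)]])
    ultimately have "open (dom_of c \<inter> k -` {..<k p + 1})"
      by (intro continuous_open_preimage) auto
    moreover have "\<bar>grad_inner q v w\<bar> \<le> (k p + 1) * norm v * norm w"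
      if "q \<in> dom_of c \<inter> k -` {..<k p + 1}" for q v w
    proof -
      have "\<bar>grad_inner q v w\<bar> \<le> (\<Sum>i\<in>UNIV. \<Sum>j\<in>UNIV. \<bar>matrix_inv (G c (crd c q)) $ i $ j\<bar>
          * (norm (pd j (\<phi> \<circ> cinv c) (crd c q)) * norm v)
          * (norm (pd i (\<phi> \<circ> cinv c) (crd c q)) * norm w))"
        unfolding grad_inner_coord[OF c(1) IntD1[OF that]]
        by (intro order_trans[OF sum_abs] sum_mono order_trans[OF sum_abs])
          (auto simp: abs_mult intro!: mult_mono Cauchy_Schwarz_ineq2)
      also have "\<dots> = k q * norm v * norm w"
        by (simp add: k_def sum_distrib_right sum_distrib_left algebra_simps)
      also have "\<dots> \<le> (k p + 1) * norm v * norm w"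
        using that by (intro mult_right_mono) auto
      finally show ?thesis .
    qed
    ultimately show ?thesis
      using c by (intro exI[of _ "dom_of c \<inter> k -` {..<k p + 1}"] exI[of _ "k p + 1"]) auto
  qed
  fix p C C'
  assume C: "\<forall>v w. \<bar>grad_inner p v w\<bar> \<le> C * norm v * norm w" "C \<le> C'"
  have "C * norm v * norm w \<le> C' * norm v * norm w" for v w :: 'f
    using C(2) by (intro mult_right_mono) auto
  then show "\<forall>v w. \<bar>grad_inner p v w\<bar> \<le> C' * norm v * norm w"
    using C(1) order_trans by blast
qed

section \<open>Integrals against finite measures\<close>

lemma integrable_continuous:
  assumes "\<mu> \<in> finite_measures" and u: "continuous_on UNIV (u :: 'm \<Rightarrow> real)"
  shows "integrable \<mu> u"
proof -
  interpret finite_measure \<mu>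
    using assms by (simp add: finite_measures_def)
  have "sets \<mu> = sets borel"
    using assms by (simp add: finite_measures_def)
  then have "u \<in> borel_measurable \<mu>"
    using borel_measurable_continuous_onI[OF u] measurable_cong_sets by blast
  moreover obtain B where "\<And>p. norm (u p) \<le> B"
    using compact_imp_bounded[OF compact_continuous_image[OF u compact_UNIV]]
    by (auto simp: bounded_iff)
  ultimately show ?thesis
    by (intro integrable_const_bound[where B = B] AE_I2)
qed

lemma abs_integral_le:
  fixes u :: "'m \<Rightarrow> real"
  assumes \<mu>: "\<mu> \<in> finite_measures" and u: "continuous_on UNIV u" and le: "\<And>p. \<bar>u p\<bar> \<le> C"
  shows "\<bar>\<integral>p. u p \<partial>\<mu>\<bar> \<le> C * measure \<mu> UNIV"
proof -
  have space: "space \<mu> = UNIV"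
    using \<mu> sets_eq_imp_space_eq[of \<mu> borel] by (simp add: finite_measures_def)
  have "\<bar>\<integral>p. u p \<partial>\<mu>\<bar> \<le> (\<integral>p. \<bar>u p\<bar> \<partial>\<mu>)"
    by (rule integral_abs_bound)
  also have "\<dots> \<le> (\<integral>p. C \<partial>\<mu>)"
    using le by (intro integral_mono integrable_continuous[OF \<mu>] continuous_intros u)
  finally show ?thesis
    by (simp add: space mult.commute)
qed

text \<open>The vector-valued integral exists because \<open>\<phi>\<close> is continuous on a
  compact manifold and so has compact range.\<close>

lemma bochner_int_inner:
  assumes \<mu>: "\<mu> \<in> finite_measures"
  shows "(\<integral>p. \<phi> p \<bullet> v \<partial>\<mu>) = bochner_int \<mu> \<phi> \<bullet> v"
proof -
  have "\<phi> \<in> borel_measurable \<mu>"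
    using borel_measurable_continuous_onI[OF continuous_on_phi] measurable_cong_sets \<mu>
    unfolding finite_measures_def by blast
  then obtain x where "has_bochner_int \<mu> \<phi> x"
    using has_bochner_int_compact_range[of \<mu> \<phi> "range \<phi>"] \<mu>
      compact_continuous_image[OF continuous_on_phi compact_UNIV]
    by (auto simp: finite_measures_def)
  then have "has_bochner_integral \<mu> (\<lambda>p. \<phi> p \<bullet> v) (bochner_int \<mu> \<phi> \<bullet> v)"
    by (intro has_bochner_int_inner has_bochner_int_bochner_int)
  then show ?thesis
    by (rule has_bochner_integral_integral_eq)
qed

lemma integral_test:
  assumes \<mu>: "\<mu> \<in> finite_measures"
  shows "(\<integral>p. test v k p \<partial>\<mu>) = bochner_int \<mu> \<phi> \<bullet> v + k * measure \<mu> UNIV"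
proof -
  have space: "space \<mu> = UNIV"
    using \<mu> sets_eq_imp_space_eq[of \<mu> borel] by (simp add: finite_measures_def)
  have "(\<integral>p. test v k p \<partial>\<mu>) = (\<integral>p. \<phi> p \<bullet> v \<partial>\<mu>) + (\<integral>p. k \<partial>\<mu>)"
    unfolding test_def
    by (intro Bochner_Integration.integral_add integrable_continuous[OF \<mu>] continuous_intros continuous_on_phi)
  then show ?thesis
    by (simp add: bochner_int_inner[OF \<mu>] space mult.commute)
qed

lemma J_star_le:
  assumes "\<mu> \<in> finite_measures"
  shows "J_star \<phi> R lam \<le> J \<phi> R lam \<mu>"
proof -
  have "bdd_below (J \<phi> R lam ` finite_measures)"
    using R_nonneg lam_pos by (intro bdd_belowI2[of _ 0]) (simp add: J_def)
  then show ?thesis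
    unfolding J_star_def using assms by (rule cINF_lower)
qed

text \<open>Jensen's inequality: the barycentre of \<open>m \<phi>\<close> with respect to \<open>\<mu> / m\<close> is the integral of \<open>\<phi>\<close>,
  where \<open>m\<close> is the mass of \<open>\<mu>\<close>.\<close>

lemma R_bounded_of_mass_bounded:
  assumes "convex_on UNIV R"
  shows "\<exists>B. \<forall>\<mu>\<in>finite_measures. measure \<mu> UNIV \<le> M \<longrightarrow> R (bochner_int \<mu> \<phi>) \<le> B"
proof -
  have "continuous_on UNIV (\<lambda>p. R (M *\<^sub>R \<phi> p))"
    by (intro continuous_on_compose2[OF continuous_on_R] continuous_intros continuous_on_phi) auto
  from compact_imp_bounded[OF compact_continuous_image[OF this compact_UNIV]]
  obtain B where "\<And>p. norm (R (M *\<^sub>R \<phi> p)) \<le> B"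
    by (auto simp: bounded_iff)
  then have B: "R (M *\<^sub>R \<phi> p) \<le> B" "0 \<le> B" for p
    using R_nonneg[of "M *\<^sub>R \<phi> p"] by (auto simp: abs_le_iff intro: order_trans)
  have "R (bochner_int \<mu> \<phi>) \<le> R 0 + B" if \<mu>: "\<mu> \<in> finite_measures" and le: "measure \<mu> UNIV \<le> M" for \<mu>
  proof -
    define m where "m = measure \<mu> UNIV"
    define x where "x = bochner_int \<mu> \<phi>"
    show ?thesis
    proof (cases "m = 0")
      case True
      \<comment> \<open>A measure of mass zero cannot be normalised; testing the integral of
        \<open>\<phi>\<close> against itself shows that it vanishes.\<close>
      have "(norm x)\<^sup>2 = (\<integral>p. \<phi> p \<bullet> x \<partial>\<mu>)"
        using bochner_int_inner[OF \<mu>, of x] by (simp add: x_def power2_norm_eq_inner)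
      also have "\<dots> \<le> 0"
      proof -
        obtain C where "C > 0" and C: "\<And>p. norm (\<phi> p) \<le> C"
          using phi_bounded by blast
        have "\<bar>\<phi> p \<bullet> x\<bar> \<le> C * norm x" for p
          using Cauchy_Schwarz_ineq2[of "\<phi> p" x] C[of p]
          by (elim order_trans) (simp add: mult_right_mono)
        then have "\<bar>\<integral>p. \<phi> p \<bullet> x \<partial>\<mu>\<bar> \<le> C * norm x * measure \<mu> UNIV"
          by (intro abs_integral_le[OF \<mu>] continuous_intros continuous_on_phi)
        then show ?thesis
          using True by (simp add: m_def)
      qed
      finally have "x = 0"
        by simp
      then show ?thesis
        using B(2) by (simp add: x_def)
    next
      case False
      then have "m > 0"
        by (simp add: m_def less_le)
      \<comment> \<open>\<open>m *\<^sub>R \<phi> p\<close> lies on the segment from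
        \<open>0\<close> to \<open>M *\<^sub>R \<phi> p\<close>, so convexity carries the bound at
        mass \<open>M\<close> over to every smaller mass.\<close>
      have R_m: "R (m *\<^sub>R \<phi> p) \<le> R 0 + B" for p
      proof -
        have "R ((1 - m / M) *\<^sub>R 0 + (m / M) *\<^sub>R (M *\<^sub>R \<phi> p)) \<le> (1 - m / M) * R 0 + (m / M) * R (M *\<^sub>R \<phi> p)"
          using \<open>m > 0\<close> le by (intro convex_onD[OF assms]) (auto simp: m_def)
        also have "\<dots> \<le> 1 * R 0 + 1 * B"
          using \<open>m > 0\<close> le B R_nonneg by (intro add_mono mult_mono) (auto simp: m_def)
        finally show ?thesis
          using \<open>m > 0\<close> le by (simp add: m_def)
      qed
      \<comment> \<open>The integrand is the slack left by \<open>R_m\<close> in the tangent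
        inequality at \<open>x\<close> for the point \<open>m *\<^sub>R \<phi> p\<close>. After
        integration the gradient terms cancel, since \<open>x\<close> is the integral of
        \<open>\<phi>\<close>.\<close>
      have "0 \<le> (\<integral>p. test (- (m *\<^sub>R grad R x)) (R 0 + B - R x + x \<bullet> grad R x) p \<partial>\<mu>)"
      proof (rule Bochner_Integration.integral_nonneg)
        fix p
        show "0 \<le> test (- (m *\<^sub>R grad R x)) (R 0 + B - R x + x \<bullet> grad R x) p"
          using convex_grad_ineq[OF assms GDERIV_R, of x "m *\<^sub>R \<phi> p"] R_m[of p]
          by (simp add: test_def inner_diff_left)
      qed
      also have "\<dots> = m * (R 0 + B - R x)"
        by (simp add: integral_test[OF \<mu>] x_def m_def algebra_simps)
      finally show ?thesis
        using \<open>m > 0\<close> by (simp add: zero_le_mult_iff x_def)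
    qed
  qed
  then show ?thesis
    by blast
qed

end

section \<open>Energy dissipation along the flow\<close>

locale gradient_flow = smooth_objective A G \<phi> R lam
  for A :: "('m::t2_space, 'd::finite) chart set"
    and G :: "('m, 'd) metric_tensor"
    and \<phi> :: "'m \<Rightarrow> 'f::{real_inner,complete_space}"
    and R :: "'f \<Rightarrow> real"
    and lam :: real +
  fixes \<alpha> \<beta> :: real and \<nu> :: "real \<Rightarrow> 'm measure"
  assumes convex: "convex_on UNIV R" and pos: "\<alpha> > 0" "\<beta> > 0"
    and flow: "projected_gradient_flow A G \<phi> R lam \<alpha> \<beta> \<nu>"
begin

definition f :: "real \<Rightarrow> 'f" where
  "f t = bochner_int (\<nu> t) \<phi>"

definition g :: "real \<Rightarrow> 'f" where
  "g t = grad R (f t)"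

definition mass :: "real \<Rightarrow> real" where
  "mass t = measure (\<nu> t) UNIV"

definition obj :: "real \<Rightarrow> real" where
  "obj t = J \<phi> R lam (\<nu> t)"

text \<open>By the weak formulation this is, for almost every \<open>t\<close>, minus the rate of
  change of the integral of \<open>test v k\<close>. The test function is kept separate from the
  time, so that it can be frozen; \<open>v = g t\<close> and \<open>k = lam\<close> give the
  dissipation of the objective.\<close>

definition dissip :: "'f \<Rightarrow> real \<Rightarrow> real \<Rightarrow> real" where
  "dissip v k t = (\<integral>p. 4 * \<alpha> * test v k p * test (g t) lam p + \<beta> * grad_inner p v (g t) \<partial>\<nu> t)"

lemma flow_finite: "t \<ge> 0 \<Longrightarrow> \<nu> t \<in> finite_measures"
  using flow by (simp add: projected_gradient_flow_def)

lemma continuous_on_dissip_integrand: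
  "continuous_on UNIV (\<lambda>p. 4 * \<alpha> * test v k p * test w l p + \<beta> * grad_inner p v w)"
  by (intro continuous_intros continuous_on_test continuous_on_grad_inner)

text \<open>The exceptional null set of the weak formulation depends on \<open>v\<close> and
  \<open>k\<close>. For one fixed pair, absolute continuity removes it, provided that the rate is
  bounded at every time in between.\<close>

lemma flow_test_increment:
  assumes "0 \<le> s" "s \<le> t" and C: "\<And>\<tau>. s \<le> \<tau> \<Longrightarrow> \<tau> \<le> t \<Longrightarrow> - dissip v k \<tau> \<le> C"
  shows "(f t - f s) \<bullet> v + k * (mass t - mass s) \<le> C * (t - s)"
proof -
  define h where "h \<tau> = (\<integral>p. test v k p \<partial>\<nu> \<tau>)" for \<tau>
  have h: "h \<tau> = f \<tau> \<bullet> v + k * mass \<tau>" if "\<tau> \<ge> 0" for \<tau>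
    using integral_test[OF flow_finite[OF that]] by (simp add: h_def f_def mass_def)
  have "(\<forall>T\<ge>0. abs_cont_on 0 T (\<lambda>\<tau>. \<integral>p. test v k p \<partial>\<nu> \<tau>))
      \<and> (AE \<tau> in lborel. \<tau> \<ge> 0 \<longrightarrow> ((\<lambda>s. \<integral>p. test v k p \<partial>\<nu> s) has_real_derivative
          - (\<integral>p. 4 * \<alpha> * test v k p * J' \<phi> R lam (\<nu> \<tau>) p
              + \<beta> * riem_inner A G p (grad_vec G (test v k) p) (grad_vec G (J' \<phi> R lam (\<nu> \<tau>)) p)
            \<partial>\<nu> \<tau>)) (at \<tau> within {0..}))"
    using flow C1_test[of v k] unfolding projected_gradient_flow_def by blast
  then have ac: "abs_cont_on 0 t h"
    and ae: "AE \<tau> in lborel. \<tau> \<ge> 0 \<longrightarrow> (h has_real_derivative - dissip v k \<tau>) (at \<tau> within {0..})"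
    using assms(1,2) unfolding J'_eq_test riem_inner_test_eq
    by (simp_all add: h_def[abs_def] dissip_def g_def f_def)
  have "h t - h s \<le> C * (t - s)"
  proof (rule abs_cont_on_increment_le[OF abs_cont_on_subset[OF ac assms(1) order_refl] assms(2)])
    show "AE \<tau> in lborel. \<tau> \<in> {s..t} \<longrightarrow> (\<exists>D\<le>C. (h has_real_derivative D) (at \<tau> within {s..t}))"
      using ae
    proof eventually_elim
      case (elim \<tau>)
      show ?case
      proof
        assume \<tau>: "\<tau> \<in> {s..t}"
        then have "(h has_real_derivative - dissip v k \<tau>) (at \<tau> within {0..})"
          using elim \<open>0 \<le> s\<close> by simp
        then have "(h has_real_derivative - dissip v k \<tau>) (at \<tau> within {s..t})"
          by (rule DERIV_subset) (use \<open>0 \<le> s\<close> in auto)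
        then show "\<exists>D\<le>C. (h has_real_derivative D) (at \<tau> within {s..t})"
          using C[of \<tau>] \<tau> by auto
      qed
    qed
  qed
  then show ?thesis
    using assms(1,2) by (simp add: h inner_diff_left algebra_simps)
qed

section \<open>Bounds and continuity in time\<close>

lemma continuous_on_mass: "continuous_on {0..T} mass"
proof (cases "T \<ge> 0")
  case True
  have "abs_cont_on 0 T (\<lambda>t. \<integral>p. test 0 1 p \<partial>\<nu> t)"
    using flow C1_test[of 0 1] True unfolding projected_gradient_flow_def by blast
  then show ?thesis
    by (rule continuous_on_eq[OF abs_cont_on_imp_continuous_on])
      (simp add: integral_test[OF flow_finite] mass_def)
qed simp

text \<open>Linearity in the test function: exchanging the current gradient for a frozen one costs
  the dissipation of the difference, with no constant term.\<close>

lemma dissip_diff: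
  assumes "t \<ge> 0"
  shows "dissip v k t - dissip w k t = dissip (v - w) 0 t"
proof -
  have "4 * \<alpha> * test (v - w) 0 p * test (g t) lam p + \<beta> * grad_inner p (v - w) (g t)
      = (4 * \<alpha> * test v k p * test (g t) lam p + \<beta> * grad_inner p v (g t))
      - (4 * \<alpha> * test w k p * test (g t) lam p + \<beta> * grad_inner p w (g t))" for p
    by (simp add: test_def inner_diff_right grad_inner_diff_left algebra_simps)
  then show ?thesis
    unfolding dissip_def
    by (simp add: Bochner_Integration.integral_diff[OF
          integrable_continuous[OF flow_finite[OF assms] continuous_on_dissip_integrand]
          integrable_continuous[OF flow_finite[OF assms] continuous_on_dissip_integrand]])
qed

text \<open>Monotonicity of the objective is not yet available. Instead, continuity bounds the mass
  on \<open>{0..T}\<close>, Jensen's inequality then bounds \<open>R\<close>, and the sublevel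
  assumption bounds its gradient.\<close>

lemma grad_along_flow_bounded: "\<exists>B>0. \<forall>t\<in>{0..T}. norm (g t) \<le> B \<and> mass t \<le> B"
proof -
  have "bounded (mass ` {0..T})"
    by (intro compact_imp_bounded compact_continuous_image continuous_on_mass) simp
  then obtain M where M: "\<And>t. t \<in> {0..T} \<Longrightarrow> mass t \<le> M"
    unfolding bounded_iff by (metis abs_le_D1 image_eqI real_norm_def)
  obtain B where B: "\<And>\<mu>. \<mu> \<in> finite_measures \<Longrightarrow> measure \<mu> UNIV \<le> M \<Longrightarrow> R (bochner_int \<mu> \<phi>) \<le> B"
    using R_bounded_of_mass_bounded[OF convex] by blast
  obtain C where C: "\<And>x. R x \<le> B \<Longrightarrow> norm (grad R x) \<le> C"
    using bounded_grad_sublevel[of B] unfolding bounded_iff by blast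
  have "norm (g t) \<le> C" if "t \<in> {0..T}" for t
    unfolding g_def f_def using that M[OF that] by (intro C B) (auto simp: mass_def flow_finite)
  then have "norm (g t) \<le> max (max C M) 1 \<and> mass t \<le> max (max C M) 1" if "t \<in> {0..T}" for t
    using M that by fastforce
  then show ?thesis
    by (intro exI[of _ "max (max C M) 1"]) auto
qed

lemma dissip_bounded: "\<exists>L>0. \<forall>t\<in>{0..T}. \<forall>v. \<bar>dissip v 0 t\<bar> \<le> L * norm v"
proof -
  obtain B where "B > 0" and B: "\<And>t. t \<in> {0..T} \<Longrightarrow> norm (g t) \<le> B" "\<And>t. t \<in> {0..T} \<Longrightarrow> mass t \<le> B"
    using grad_along_flow_bounded by blast
  obtain C where "C > 0" and C: "\<And>p. norm (\<phi> p) \<le> C"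
    using phi_bounded by blast
  obtain K where "K > 0" and K: "\<And>p v w. \<bar>grad_inner p v w\<bar> \<le> K * norm v * norm w"
    using grad_inner_bounded by blast
  \<comment> \<open>The factors bound \<open>test v 0\<close> by \<open>C * norm v\<close>, the
    first variation by \<open>C * B + lam\<close>, and the gradient pairing by
    \<open>K * norm v * B\<close>. The mass contributes one more factor \<open>B\<close> at the
    end.\<close>
  define L where "L = 4 * \<alpha> * C * (C * B + lam) + \<beta> * K * B"
  have "L > 0"
    unfolding L_def using pos \<open>B > 0\<close> \<open>C > 0\<close> \<open>K > 0\<close> lam_pos by (intro add_pos_pos mult_pos_pos) auto
  have "\<bar>dissip v 0 t\<bar> \<le> L * B * norm v" if t: "t \<in> {0..T}" for t v
  proof -
    have inner_le: "\<bar>\<phi> p \<bullet> w\<bar> \<le> C * norm w" for p w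
      using Cauchy_Schwarz_ineq2[of "\<phi> p" w] mult_right_mono[OF C[of p] norm_ge_zero[of w]] by linarith
    have "\<bar>4 * \<alpha> * test v 0 p * test (g t) lam p + \<beta> * grad_inner p v (g t)\<bar> \<le> L * norm v" for p
    proof -
      have "\<bar>test (g t) lam p\<bar> \<le> C * B + lam"
      proof -
        have "C * norm (g t) \<le> C * B"
          using B(1)[OF t] \<open>C > 0\<close> by simp
        then show ?thesis
          using inner_le[of p "g t"] lam_pos unfolding test_def by linarith
      qed
      moreover have "\<bar>test v 0 p\<bar> \<le> C * norm v"
        using inner_le by (simp add: test_def)
      ultimately have "\<bar>test v 0 p\<bar> * \<bar>test (g t) lam p\<bar> \<le> (C * norm v) * (C * B + lam)"
        using \<open>C > 0\<close> by (intro mult_mono) auto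
      then have "4 * \<alpha> * (\<bar>test v 0 p\<bar> * \<bar>test (g t) lam p\<bar>) \<le> 4 * \<alpha> * ((C * norm v) * (C * B + lam))"
        using pos by (intro mult_left_mono) auto
      moreover have "\<bar>grad_inner p v (g t)\<bar> \<le> K * norm v * B"
        using B(1)[OF t] \<open>K > 0\<close> by (intro order_trans[OF K] mult_left_mono) auto
      then have "\<beta> * \<bar>grad_inner p v (g t)\<bar> \<le> \<beta> * (K * norm v * B)"
        using pos by (intro mult_left_mono) auto
      moreover have "\<bar>4 * \<alpha> * test v 0 p * test (g t) lam p + \<beta> * grad_inner p v (g t)\<bar>
          \<le> 4 * \<alpha> * (\<bar>test v 0 p\<bar> * \<bar>test (g t) lam p\<bar>) + \<beta> * \<bar>grad_inner p v (g t)\<bar>"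
        using pos abs_triangle_ineq[of "4 * \<alpha> * test v 0 p * test (g t) lam p" "\<beta> * grad_inner p v (g t)"]
        by (simp add: abs_mult)
      ultimately show ?thesis
        by (simp add: L_def algebra_simps)
    qed
    then have "\<bar>dissip v 0 t\<bar> \<le> L * norm v * mass t"
      unfolding dissip_def mass_def using t
      by (intro abs_integral_le continuous_on_dissip_integrand flow_finite) auto
    also have "\<dots> \<le> L * norm v * B"
      using B(2)[OF t] \<open>L > 0\<close> by (intro mult_left_mono) auto
    finally show ?thesis
      by (simp add: mult_ac)
  qed
  then show ?thesis
    using \<open>L > 0\<close> \<open>B > 0\<close> by (intro exI[of _ "L * B"]) auto
qed

text \<open>Duality: testing against the increment \<open>v = f t - f s\<close> itself gives
  \<open>norm v * norm v \<le> L * norm v * (t - s)\<close>, hence a Lipschitz bound.\<close>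

lemma continuous_on_f: "continuous_on {0..T} f"
proof -
  obtain L where "L > 0" and L: "\<And>t v. t \<in> {0..T} \<Longrightarrow> \<bar>dissip v 0 t\<bar> \<le> L * norm v"
    using dissip_bounded by blast
  have le: "norm (f t - f s) \<le> L * (t - s)" if "0 \<le> s" "s \<le> t" "t \<le> T" for s t
  proof -
    define v where "v = f t - f s"
    have "- dissip v 0 \<tau> \<le> L * norm v" if "s \<le> \<tau>" "\<tau> \<le> t" for \<tau>
      using L[of \<tau> v] that \<open>0 \<le> s\<close> \<open>t \<le> T\<close> by auto
    then have "norm v * norm v \<le> L * norm v * (t - s)"
      using flow_test_increment[OF that(1,2), of v 0 "L * norm v"]
      by (simp add: v_def power2_norm_eq_inner[symmetric] power2_eq_square)
    then show ?thesis
      using that \<open>L > 0\<close> by (cases "v = 0") (auto simp: v_def[symmetric])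
  qed
  have "dist (f s) (f t) \<le> L * dist s t" if "s \<in> {0..T}" "t \<in> {0..T}" for s t
    using le[of s t] le[of t s] that
    by (cases "s \<le> t") (auto simp: dist_norm norm_minus_commute abs_if)
  then have "L-lipschitz_on {0..T} f"
    using \<open>L > 0\<close> by (intro lipschitz_onI) auto
  then show ?thesis
    by (rule lipschitz_on_continuous_on)
qed

lemma continuous_on_g: "continuous_on {0..T} g"
  unfolding g_def by (rule continuous_on_compose2[OF continuous_on_grad_R continuous_on_f]) simp

lemma continuous_on_obj: "continuous_on {0..T} obj"
proof -
  have "continuous_on {0..T} (\<lambda>t. R (f t) + lam * mass t)"
    by (intro continuous_intros continuous_on_compose2[OF continuous_on_R continuous_on_f] continuous_on_mass) simp
  then show ?thesis
    by (simp add: obj_def[abs_def] J_def f_def mass_def)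
qed

text \<open>Testing the flow against the first variation frozen at time \<open>t\<close> yields the left Dini derivative
  of the objective: by convexity the linearisation at \<open>t\<close> bounds the increment over \<open>[s, t]\<close> from
  above, and the dissipation integrand is continuous in the frozen gradient.\<close>

lemma obj_left_Dini:
  assumes t: "0 < t" "t \<le> T" and "e > 0" and "c \<ge> 0"
    and D: "\<And>\<tau>. \<tau> \<in> {0..T} \<Longrightarrow> c * (obj \<tau> - j) \<le> dissip (g \<tau>) lam \<tau>"
  shows "\<exists>d>0. \<forall>s. 0 \<le> s \<and> t - d < s \<and> s < t
    \<longrightarrow> obj t - obj s \<le> (e - c * (obj t - j)) * (t - s) \<and> \<bar>obj t - obj s\<bar> < e"
proof -
  obtain L where "L > 0" and L: "\<And>t v. t \<in> {0..T} \<Longrightarrow> \<bar>dissip v 0 t\<bar> \<le> L * norm v"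
    using dissip_bounded by blast
  have tT: "t \<in> {0..T}"
    using t by auto
  obtain d1 where "d1 > 0" and d1: "\<And>\<tau>. \<tau> \<in> {0..T} \<Longrightarrow> dist \<tau> t < d1 \<Longrightarrow> dist (g \<tau>) (g t) < e / (2 * L)"
    using continuous_on_g[of T] tT \<open>e > 0\<close> \<open>L > 0\<close> unfolding continuous_on_iff
    by (metis divide_pos_pos mult_pos_pos zero_less_numeral)
  \<comment> \<open>The tolerance for \<open>obj\<close> is chosen so that replacing
    \<open>obj \<tau>\<close> by \<open>obj t\<close> costs \<open>e / 2\<close> after
    multiplication by \<open>c\<close>; the denominator has \<open>c + 1\<close> because
    \<open>c\<close> may vanish.\<close>
  define e' where "e' = min e (e / (2 * (c + 1)))"
  have e': "0 < e'" "e' \<le> e" "c * e' \<le> e / 2"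
  proof -
    show "0 < e'" "e' \<le> e"
      using \<open>e > 0\<close> \<open>c \<ge> 0\<close> by (auto simp: e'_def)
    have "c * e' \<le> (c + 1) * (e / (2 * (c + 1)))"
      using \<open>e > 0\<close> \<open>c \<ge> 0\<close> by (intro mult_mono) (auto simp: e'_def)
    also have "\<dots> = e / 2"
      using \<open>c \<ge> 0\<close> by (simp add: field_simps)
    finally show "c * e' \<le> e / 2" .
  qed
  obtain d2 where "d2 > 0" and d2: "\<And>\<tau>. \<tau> \<in> {0..T} \<Longrightarrow> dist \<tau> t < d2 \<Longrightarrow> dist (obj \<tau>) (obj t) < e'"
    using continuous_on_obj[of T] tT e'(1) unfolding continuous_on_iff by metis
  have "obj t - obj s \<le> (e - c * (obj t - j)) * (t - s) \<and> \<bar>obj t - obj s\<bar> < e"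
    if s: "0 \<le> s" "t - min d1 d2 < s" "s < t" for s
  proof
    \<comment> \<open>The lower bound \<open>D\<close> concerns the gradient at time
      \<open>\<tau>\<close>. Passing to the gradient frozen at \<open>t\<close> costs one half of
      \<open>e\<close>, passing from \<open>obj \<tau>\<close> to \<open>obj t\<close> the other
      half.\<close>
    have "- dissip (g t) lam \<tau> \<le> e - c * (obj t - j)" if "s \<le> \<tau>" "\<tau> \<le> t" for \<tau>
    proof -
      have \<tau>: "\<tau> \<in> {0..T}" "dist \<tau> t < d1" "dist \<tau> t < d2"
        using that s t by (auto simp: dist_real_def)
      have "\<bar>dissip (g t - g \<tau>) 0 \<tau>\<bar> \<le> L * norm (g t - g \<tau>)"
        using L \<tau> by blast
      also have "\<dots> \<le> L * (e / (2 * L))"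
        using d1[OF \<tau>(1,2)] \<open>L > 0\<close>
        by (intro mult_left_mono) (auto simp: dist_norm norm_minus_commute)
      finally have "\<bar>dissip (g t - g \<tau>) 0 \<tau>\<bar> \<le> e / 2"
        using \<open>L > 0\<close> by simp
      moreover have "c * (obj t - obj \<tau>) \<le> e / 2"
      proof -
        have "c * (obj t - obj \<tau>) \<le> c * e'"
          using d2[OF \<tau>(1,3)] \<open>c \<ge> 0\<close> by (intro mult_left_mono) (auto simp: dist_real_def)
        then show ?thesis
          using e'(3) by linarith
      qed
      ultimately show ?thesis
        using dissip_diff[of \<tau> "g t" lam "g \<tau>"] D[OF \<tau>(1)] \<tau>(1) by (simp add: algebra_simps abs_le_iff)
    qed
    then have "(f t - f s) \<bullet> g t + lam * (mass t - mass s) \<le> (e - c * (obj t - j)) * (t - s)"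
      using s by (intro flow_test_increment) auto
    moreover have "R (f s) \<ge> R (f t) + (f s - f t) \<bullet> g t"
      unfolding g_def by (rule convex_grad_ineq[OF convex GDERIV_R])
    ultimately show "obj t - obj s \<le> (e - c * (obj t - j)) * (t - s)"
      by (simp add: obj_def J_def f_def[symmetric] mass_def[symmetric] inner_diff_left algebra_simps)
    have "dist (obj s) (obj t) < e'"
      using s t by (intro d2) (auto simp: dist_real_def)
    then show "\<bar>obj t - obj s\<bar> < e"
      using e'(2) by (simp add: dist_real_def abs_minus_commute)
  qed
  then show ?thesis
    using \<open>d1 > 0\<close> \<open>d2 > 0\<close> by (intro exI[of _ "min d1 d2"]) auto
qed

text \<open>Gronwall's argument with the integrating factor \<open>exp (c * t)\<close>, carried out
  with left Dini bounds. The rate \<open>c\<close> may be zero, in which case the statement is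
  monotonicity of the objective.\<close>

lemma obj_exponential_decay:
  assumes "T \<ge> 0" and "c \<ge> 0" and j: "\<And>\<tau>. \<tau> \<in> {0..T} \<Longrightarrow> j \<le> obj \<tau>"
    and D: "\<And>\<tau>. \<tau> \<in> {0..T} \<Longrightarrow> c * (obj \<tau> - j) \<le> dissip (g \<tau>) lam \<tau>"
  shows "obj T - j \<le> (obj 0 - j) * exp (- c * T)"
proof -
  have "exp (c * T) * (obj T - j) \<le> exp (c * 0) * (obj 0 - j)"
  proof (rule nonincreasing_of_left_Dini[where g = "\<lambda>t. exp (c * t) * (obj t - j)", OF \<open>T \<ge> 0\<close>])
    show "continuous_on {0..T} (\<lambda>t. exp (c * t) * (obj t - j))"
      by (intro continuous_intros continuous_on_obj)
    fix t e :: real assume t: "0 < t" "t \<le> T" and "e > 0"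
    \<comment> \<open>Scaled so that \<open>exp (c * t) * (c + 1) * e' = e\<close>: one
      \<open>e'\<close> comes from the Dini bound, and \<open>c * e'\<close> from replacing
      \<open>obj s\<close> by \<open>obj t\<close>.\<close>
    define e' where "e' = e / (exp (c * t) * (c + 1))"
    have "e' > 0"
      using \<open>e > 0\<close> \<open>c \<ge> 0\<close> by (simp add: e'_def)
    obtain d where "d > 0" and d: "\<And>s. 0 \<le> s \<Longrightarrow> t - d < s \<Longrightarrow> s < t
        \<Longrightarrow> obj t - obj s \<le> (e' - c * (obj t - j)) * (t - s) \<and> \<bar>obj t - obj s\<bar> < e'"
      using obj_left_Dini[OF t \<open>e' > 0\<close> \<open>c \<ge> 0\<close> D] by blast
    have "exp (c * t) * (obj t - j) - exp (c * s) * (obj s - j) \<le> e * (t - s)"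
      if s: "0 \<le> s" "t - d < s" "s < t" for s
    proof -
      \<comment> \<open>The tangent to the exponential bounds \<open>exp (c * s)\<close> from below
        by quantities at time \<open>t\<close>; it may be multiplied by \<open>obj s - j\<close>,
        which is nonnegative.\<close>
      have "1 - c * (t - s) \<le> exp (- (c * (t - s)))"
        using exp_ge_add_one_self[of "- (c * (t - s))"] by simp
      then have "exp (c * t) * (1 - c * (t - s)) \<le> exp (c * t) * exp (- (c * (t - s)))"
        by (intro mult_left_mono) auto
      also have "\<dots> = exp (c * s)"
        by (simp add: exp_add[symmetric] algebra_simps)
      finally have "exp (c * t) * (1 - c * (t - s)) * (obj s - j) \<le> exp (c * s) * (obj s - j)"
        using j[of s] s t by (intro mult_right_mono) auto
      then have "exp (c * t) * (obj t - j) - exp (c * s) * (obj s - j)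
          \<le> exp (c * t) * (obj t - obj s + c * (t - s) * (obj s - j))"
        by (simp add: algebra_simps)
      also have "\<dots> \<le> exp (c * t) * ((c + 1) * e' * (t - s))"
      proof (rule mult_left_mono)
        have "c * (obj s - obj t) * (t - s) \<le> c * e' * (t - s)"
          using d[OF s] s \<open>c \<ge> 0\<close> by (intro mult_right_mono mult_left_mono) auto
        then show "obj t - obj s + c * (t - s) * (obj s - j) \<le> (c + 1) * e' * (t - s)"
          using d[OF s] by (simp add: algebra_simps)
      qed simp
      also have "\<dots> = e * (t - s)"
        using \<open>c \<ge> 0\<close> by (simp add: e'_def)
      finally show ?thesis .
    qed
    then show "\<exists>d>0. \<forall>s. 0 \<le> s \<and> t - d < s \<and> s < t
        \<longrightarrow> exp (c * t) * (obj t - j) - exp (c * s) * (obj s - j) \<le> e * (t - s)"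
      using \<open>d > 0\<close> by blast
  qed
  then show ?thesis
    by (simp add: exp_minus field_simps)
qed

text \<open>Up to the factor \<open>1/2\<close>, this is the left-hand side of the sharpness
  inequality. Nonnegativity of the gradient pairing undoes the square root in
  \<open>riem_norm\<close>.\<close>

lemma dissip_eq:
  "dissip (g t) lam t = (\<integral>p. 4 * \<alpha> * \<bar>J' \<phi> R lam (\<nu> t) p\<bar>\<^sup>2
    + \<beta> * (riem_norm A G p (grad_vec G (J' \<phi> R lam (\<nu> t)) p))\<^sup>2 \<partial>\<nu> t)"
  unfolding J'_eq_test riem_norm_def riem_inner_test_eq dissip_def g_def f_def
  by (simp add: grad_inner_nonneg power2_eq_square mult_ac)

lemma dissip_nonneg: "dissip (g t) lam t \<ge> 0"
  unfolding dissip_eq using pos by (intro Bochner_Integration.integral_nonneg) simp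

text \<open>The decay lemma at rate zero, where nonnegative dissipation suffices. It comes before
  any use of sharpness, which is available only below the threshold.\<close>

lemma obj_le_initial: "T \<ge> 0 \<Longrightarrow> obj T \<le> obj 0"
  using obj_exponential_decay[of T 0 "J_star \<phi> R lam"] J_star_le flow_finite dissip_nonneg
  by (simp add: obj_def)

end

theorem corollary3p4:
  fixes A :: "('m::t2_space, 'd::finite) chart set"
    and G :: "('m, 'd) metric_tensor"
    and \<phi> :: "'m \<Rightarrow> 'f::{real_inner,complete_space}"
    and R :: "'f \<Rightarrow> real"
    and lam :: real
    and r :: "'i::finite \<Rightarrow> real"
    and \<theta> :: "'i \<Rightarrow> 'm"
    and x :: "'i \<Rightarrow> ('m, 'd) chart"
    and a b J0 \<kappa>0 \<alpha> \<beta> :: real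
    and \<nu> :: "real \<Rightarrow> 'm measure"
  assumes "smoothness_assumption A G \<phi> R lam"
    and "convex_on UNIV R"
    and "sparse_minimizer \<phi> R lam r \<theta>"
    and "\<And>i. normal_coordinates A G (\<theta> i) (x i)"
    and "a > 0" and "b > 0" and "non_degenerate a b x G \<phi> R lam r \<theta>"
    and "J0 > J_star \<phi> R lam" and "\<kappa>0 > 0" and "sharpness A G \<phi> R lam J0 \<kappa>0"
    and "\<alpha> > 0" and "\<beta> > 0" and "projected_gradient_flow A G \<phi> R lam \<alpha> \<beta> \<nu>"
    and "J \<phi> R lam (\<nu> 0) \<le> J0"
  shows "\<forall>t\<ge>0. J \<phi> R lam (\<nu> t) - J_star \<phi> R lam
           \<le> (J \<phi> R lam (\<nu> 0) - J_star \<phi> R lam) * exp (- 2 * \<kappa>0 * min \<alpha> \<beta> * t)"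
proof (intro allI impI)
  fix t :: real assume "t \<ge> 0"
  interpret gradient_flow A G \<phi> R lam \<alpha> \<beta> \<nu>
    using assms(1,2,11,12,13) by unfold_locales
  \<comment> \<open>The factor \<open>2\<close> clears the \<open>1/2\<close> in front of the
    dissipation in the sharpness inequality.\<close>
  define c where "c = 2 * \<kappa>0 * min \<alpha> \<beta>"
  have "c * (obj \<tau> - J_star \<phi> R lam) \<le> dissip (g \<tau>) lam \<tau>" if "\<tau> \<in> {0..t}" for \<tau>
  proof -
    have "J \<phi> R lam (\<nu> \<tau>) \<le> J0"
      using obj_le_initial[of \<tau>] that assms(14) by (simp add: obj_def)
    then have "(1/2) * dissip (g \<tau>) lam \<tau> \<ge> \<kappa>0 * min \<alpha> \<beta> * (obj \<tau> - J_star \<phi> R lam)"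
      unfolding dissip_eq obj_def
      using assms(10,11,12) flow_finite[of \<tau>] that unfolding sharpness_def by auto
    then show ?thesis
      by (simp add: c_def)
  qed
  then have "obj t - J_star \<phi> R lam \<le> (obj 0 - J_star \<phi> R lam) * exp (- c * t)"
    using \<open>t \<ge> 0\<close> assms(9,11,12) J_star_le flow_finite
    by (intro obj_exponential_decay) (auto simp: c_def obj_def)
  then show "J \<phi> R lam (\<nu> t) - J_star \<phi> R lam
      \<le> (J \<phi> R lam (\<nu> 0) - J_star \<phi> R lam) * exp (- 2 * \<kappa>0 * min \<alpha> \<beta> * t)"
    by (simp add: obj_def c_def)
qed

end
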